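(* The one-dimensional all-topology two-fluid system described in the context is symmetrizable when the non-resonance condition $u\neq u_k\pm c_k$ for $k=1,2$ (both signs) is satisfied.
   Context: Thermodynamics: for each phase $k=1,2$ a complete equation of state is given by a smooth strictly concave function $(\tau_k,e_k)\mapsto s_k$, where $\rho_k>0$ is the density, $\tau_k=1/\rho_k$ the specific volume, $e_k$ the specific internal energy and $s_k$ the specific entropy. The Gibbs identity $T_k\,\mathrm{d}s_k=\mathrm{d}e_k+p_k\,\mathrm{d}\tau_k$ defines the temperature $T_k>0$ and the pressure $p_k$. The sound velocity is $c_k=\sqrt{\left.\partial p_k/\partial\rho_k\right|_{s_k}}>0$. Notation: $u_k\in\mathbb{R}$ is the velocity of phase $k$; $\alpha_1\in(0,1)$ is the volume fraction of phase 1 and $\alpha_2=1-\alpha_1$; $\rho=\alpha_1\rho_1+\alpha_2\rho_2$; $Y_k=\alpha_k\rho_k/\rho$; $u=Y_1u_1+Y_2u_2$; $E_k=e_k+u_k^2/2$; $H_k=E_k+p_k/\rho_k$; interfacial pressure $p_I=Y_2p_1+Y_1p_2$; interfacial work $(pu)_I=Y_1p_2u_1+Y_2p_1u_2$. System (one space dimension, no source terms): $$\partial_t\alpha_1+u\,\partial_x\alpha_1=0,$$ $$\partial_t(\alpha_k\rho_k)+\partial_x(\alpha_k\rho_ku_k)=0,\quad k=1,2,$$ $$\partial_t(\alpha_1\rho_1u_1)+\partial_x(\alpha_1\rho_1u_1^2+\alpha_1p_1)-p_I\partial_x\alpha_1=0,$$ $$\partial_t(\alpha_2\rho_2u_2)+\partial_x(\alpha_2\rho_2u_2^2+\alpha_2p_2)+p_I\partial_x\alpha_1=0,$$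 $$\partial_t(\alpha_1\rho_1E_1)+\partial_x(\alpha_1\rho_1H_1u_1)-(pu)_I\partial_x\alpha_1=0,$$ $$\partial_t(\alpha_2\rho_2E_2)+\partial_x(\alpha_2\rho_2H_2u_2)+(pu)_I\partial_x\alpha_1=0.$$ For smooth solutions, in the variables $\boldsymbol{U}=(\alpha_1,u_1,p_1,s_1,u_2,p_2,s_2)^\top$, the system takes the quasilinear form $\partial_t\boldsymbol{U}+\mathbf{M}(\boldsymbol{U})\partial_x\boldsymbol{U}=\boldsymbol{0}$ with a $7\times7$ matrix $\mathbf{M}(\boldsymbol{U})$. The system is symmetrizable on a set of states if there is a symmetric positive definite matrix $\mathbf{P}(\boldsymbol{U})$, depending smoothly on $\boldsymbol{U}$ in that set, such that $\mathbf{P}(\boldsymbol{U})\mathbf{M}(\boldsymbol{U})$ is symmetric. *)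

theory Defs
  imports "HOL-Analysis.Analysis"
begin

primrec times_cont_diff_on ::
  "nat \<Rightarrow> 'a::real_normed_vector set \<Rightarrow> ('a \<Rightarrow> 'b::real_normed_vector) \<Rightarrow> bool" where
  "times_cont_diff_on 0 S f \<longleftrightarrow> continuous_on S f"
| "times_cont_diff_on (Suc n) S f \<longleftrightarrow>
     (\<forall>x\<in>S. f differentiable (at x)) \<and>
     (\<forall>v. times_cont_diff_on n S (\<lambda>x. frechet_derivative f (at x) v))"

(* Meant for open S only: the derivatives are taken at x, not at x within S. *)
definition smooth_on ::
  "'a::real_normed_vector set \<Rightarrow> ('a \<Rightarrow> 'b::real_normed_vector) \<Rightarrow> bool" where
  "smooth_on S f \<longleftrightarrow> (\<forall>n. times_cont_diff_on n S f)"

definition strictly_concave_on ::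
  "'a::real_vector set \<Rightarrow> ('a \<Rightarrow> real) \<Rightarrow> bool" where
  "strictly_concave_on S f \<longleftrightarrow> convex S \<and>
     (\<forall>x\<in>S. \<forall>y\<in>S. \<forall>t. x \<noteq> y \<and> 0 < t \<and> t < 1 \<longrightarrow>
        (1 - t) * f x + t * f y < f ((1 - t) *\<^sub>R x + t *\<^sub>R y))"


section \<open>Equation of state of one phase\<close>

text \<open>Thermodynamic points are pairs (specific volume, specific internal energy).\<close>

record eos =
  eos_dom :: "(real \<times> real) set"
  entropy :: "real \<times> real \<Rightarrow> real"

text \<open>The Gibbs identity \<open>T ds = de + p d\<tau>\<close> amounts to \<open>\<partial>s/\<partial>e = 1/T\<close> and
  \<open>\<partial>s/\<partial>\<tau> = p/T\<close>; see \<open>gibbs_identity\<close> below.\<close>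

definition temperature :: "eos \<Rightarrow> real \<times> real \<Rightarrow> real" where
  "temperature A x = 1 / frechet_derivative (entropy A) (at x) (0, 1)"

definition pressure :: "eos \<Rightarrow> real \<times> real \<Rightarrow> real" where
  "pressure A x = temperature A x * frechet_derivative (entropy A) (at x) (1, 0)"

lemma gibbs_identity:
  assumes "entropy A differentiable (at x)" and "temperature A x > 0"
  shows "temperature A x * frechet_derivative (entropy A) (at x) (d\<tau>, de)
           = de + pressure A x * d\<tau>"
proof -
  let ?D = "frechet_derivative (entropy A) (at x)"
  have "linear ?D"
    using assms(1) by (rule linear_frechet_derivative)
  moreover have "(d\<tau>, de) = d\<tau> *\<^sub>R (1, 0) + de *\<^sub>R (0, 1)"
    by simp
  ultimately have "?D (d\<tau>, de) = d\<tau> * ?D (1, 0) + de * ?D (0, 1)"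
    by (simp only: linear_add linear_cmul real_scaleR_def)
  moreover have "?D (0, 1) \<noteq> 0"
    using assms(2) by (auto simp: temperature_def)
  ultimately show ?thesis
    by (simp add: pressure_def temperature_def field_simps)
qed

text \<open>\<open>isentrope_energy A s \<tau>\<close> is the energy at which the entropy is \<open>s\<close> for the given
  \<open>\<tau>\<close>. It is unique when the temperature is positive on a convex domain.\<close>

definition isentrope_energy :: "eos \<Rightarrow> real \<Rightarrow> real \<Rightarrow> real" where
  "isentrope_energy A s \<tau> = (THE e. (\<tau>, e) \<in> eos_dom A \<and> entropy A (\<tau>, e) = s)"

text \<open>The derivative of the pressure with respect to the density \<open>\<rho> = 1/\<tau>\<close> at constant
  entropy. Recall that \<open>sqrt\<close> is negative on negative reals, so \<open>sound_speed A x > 0\<close>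
  does say that this derivative is positive.\<close>

definition sound_speed :: "eos \<Rightarrow> real \<times> real \<Rightarrow> real" where
  "sound_speed A x =
     sqrt (deriv (\<lambda>\<rho>. pressure A (1 / \<rho>, isentrope_energy A (entropy A x) (1 / \<rho>)))
             (1 / fst x))"

definition complete_eos :: "eos \<Rightarrow> bool" where
  "complete_eos A \<longleftrightarrow>
     open (eos_dom A) \<and>
     (\<forall>x\<in>eos_dom A. fst x > 0) \<and>
     smooth_on (eos_dom A) (entropy A) \<and>
     strictly_concave_on (eos_dom A) (entropy A) \<and>
     (\<forall>x\<in>eos_dom A. temperature A x > 0) \<and>
     (\<forall>x\<in>eos_dom A. sound_speed A x > 0)"


section \<open>The two-fluid system\<close>

text \<open>A state is \<open>(\<alpha>\<^sub>1, u\<^sub>1, p\<^sub>1, s\<^sub>1, u\<^sub>2, p\<^sub>2, s\<^sub>2)\<close>. Phases are indexed by the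
  two-element type \<open>2\<close>, whose elements are \<open>1\<close> and \<open>2\<close>.\<close>

type_synonym state = "real^7"

definition alpha :: "state \<Rightarrow> 2 \<Rightarrow> real" where
  "alpha U k = (if k = 1 then U $ 1 else 1 - U $ 1)"

definition vel :: "state \<Rightarrow> 2 \<Rightarrow> real" where
  "vel U k = (if k = 1 then U $ 2 else U $ 5)"

definition pres :: "state \<Rightarrow> 2 \<Rightarrow> real" where
  "pres U k = (if k = 1 then U $ 3 else U $ 6)"

definition entr :: "state \<Rightarrow> 2 \<Rightarrow> real" where
  "entr U k = (if k = 1 then U $ 4 else U $ 7)"

definition ps_map :: "eos \<Rightarrow> real \<times> real \<Rightarrow> real \<times> real" where
  "ps_map A x = (pressure A x, entropy A x)"

text \<open>The admissible states. The velocities are unrestricted.\<close>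

definition states :: "(2 \<Rightarrow> eos) \<Rightarrow> state set" where
  "states A = {U. 0 < U $ 1 \<and> U $ 1 < 1 \<and>
     (\<forall>k. (pres U k, entr U k) \<in> ps_map (A k) ` eos_dom (A k))}"

text \<open>The point \<open>(\<tau>\<^sub>k, e\<^sub>k)\<close> with pressure \<open>p\<^sub>k\<close> and entropy \<open>s\<^sub>k\<close>. For a complete
  equation of state there is at most one: with \<open>T > 0\<close>, strict concavity of the entropy
  makes \<open>ps_map\<close> injective on the domain.\<close>

definition thermo :: "(2 \<Rightarrow> eos) \<Rightarrow> state \<Rightarrow> 2 \<Rightarrow> real \<times> real" where
  "thermo A U k = inv_into (eos_dom (A k)) (ps_map (A k)) (pres U k, entr U k)"

definition dens :: "(2 \<Rightarrow> eos) \<Rightarrow> state \<Rightarrow> 2 \<Rightarrow> real" where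
  "dens A U k = 1 / fst (thermo A U k)"

definition int_energy :: "(2 \<Rightarrow> eos) \<Rightarrow> state \<Rightarrow> 2 \<Rightarrow> real" where
  "int_energy A U k = snd (thermo A U k)"

definition sound :: "(2 \<Rightarrow> eos) \<Rightarrow> state \<Rightarrow> 2 \<Rightarrow> real" where
  "sound A U k = sound_speed (A k) (thermo A U k)"

definition mix_dens :: "(2 \<Rightarrow> eos) \<Rightarrow> state \<Rightarrow> real" where
  "mix_dens A U = alpha U 1 * dens A U 1 + alpha U 2 * dens A U 2"

definition mass_frac :: "(2 \<Rightarrow> eos) \<Rightarrow> state \<Rightarrow> 2 \<Rightarrow> real" where
  "mass_frac A U k = alpha U k * dens A U k / mix_dens A U"

definition mix_vel :: "(2 \<Rightarrow> eos) \<Rightarrow> state \<Rightarrow> real" where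
  "mix_vel A U = mass_frac A U 1 * vel U 1 + mass_frac A U 2 * vel U 2"

definition tot_energy :: "(2 \<Rightarrow> eos) \<Rightarrow> state \<Rightarrow> 2 \<Rightarrow> real" where
  "tot_energy A U k = int_energy A U k + (vel U k)\<^sup>2 / 2"

definition tot_enthalpy :: "(2 \<Rightarrow> eos) \<Rightarrow> state \<Rightarrow> 2 \<Rightarrow> real" where
  "tot_enthalpy A U k = tot_energy A U k + pres U k / dens A U k"

definition interf_pres :: "(2 \<Rightarrow> eos) \<Rightarrow> state \<Rightarrow> real" where
  "interf_pres A U = mass_frac A U 2 * pres U 1 + mass_frac A U 1 * pres U 2"

definition interf_work :: "(2 \<Rightarrow> eos) \<Rightarrow> state \<Rightarrow> real" where
  "interf_work A U =
     mass_frac A U 1 * pres U 2 * vel U 1 + mass_frac A U 2 * pres U 1 * vel U 2"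

text \<open>Space-time points are pairs \<open>(t, x)\<close>.\<close>

definition dt :: "(real \<times> real \<Rightarrow> 'a::real_normed_vector) \<Rightarrow> real \<times> real \<Rightarrow> 'a" where
  "dt f z = frechet_derivative f (at z) (1, 0)"

definition dx :: "(real \<times> real \<Rightarrow> 'a::real_normed_vector) \<Rightarrow> real \<times> real \<Rightarrow> 'a" where
  "dx f z = frechet_derivative f (at z) (0, 1)"

definition two_fluid_system_at ::
  "(2 \<Rightarrow> eos) \<Rightarrow> (real \<times> real \<Rightarrow> state) \<Rightarrow> real \<times> real \<Rightarrow> bool" where
  "two_fluid_system_at A U z \<longleftrightarrow>
     (let \<alpha> = (\<lambda>k y. alpha (U y) k);
          \<rho> = (\<lambda>k y. dens A (U y) k);
          u = (\<lambda>k y. vel (U y) k);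
          p = (\<lambda>k y. pres (U y) k);
          E = (\<lambda>k y. tot_energy A (U y) k);
          H = (\<lambda>k y. tot_enthalpy A (U y) k);
          pI = interf_pres A (U z);
          puI = interf_work A (U z)
      in dt (\<alpha> 1) z + mix_vel A (U z) * dx (\<alpha> 1) z = 0 \<and>
         (\<forall>k. dt (\<lambda>y. \<alpha> k y * \<rho> k y) z + dx (\<lambda>y. \<alpha> k y * \<rho> k y * u k y) z = 0) \<and>
         dt (\<lambda>y. \<alpha> 1 y * \<rho> 1 y * u 1 y) z
           + dx (\<lambda>y. \<alpha> 1 y * \<rho> 1 y * (u 1 y)\<^sup>2 + \<alpha> 1 y * p 1 y) z
           - pI * dx (\<alpha> 1) z = 0 \<and>
         dt (\<lambda>y. \<alpha> 2 y * \<rho> 2 y * u 2 y) z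
           + dx (\<lambda>y. \<alpha> 2 y * \<rho> 2 y * (u 2 y)\<^sup>2 + \<alpha> 2 y * p 2 y) z
           + pI * dx (\<alpha> 1) z = 0 \<and>
         dt (\<lambda>y. \<alpha> 1 y * \<rho> 1 y * E 1 y) z
           + dx (\<lambda>y. \<alpha> 1 y * \<rho> 1 y * H 1 y * u 1 y) z
           - puI * dx (\<alpha> 1) z = 0 \<and>
         dt (\<lambda>y. \<alpha> 2 y * \<rho> 2 y * E 2 y) z
           + dx (\<lambda>y. \<alpha> 2 y * \<rho> 2 y * H 2 y * u 2 y) z
           + puI * dx (\<alpha> 1) z = 0)"

text \<open>\<open>M\<close> is the matrix of the quasilinear form of the system. The equivalence is required
  at each space-time point, for all smooth fields and not only for solutions. Since value and
  first derivatives of a smooth field at a point can be prescribed, it determines \<open>M\<close> on the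
  admissible states.\<close>

definition quasilinear_form :: "(2 \<Rightarrow> eos) \<Rightarrow> (state \<Rightarrow> real^7^7) \<Rightarrow> bool" where
  "quasilinear_form A M \<longleftrightarrow>
     (\<forall>\<Omega> U. open \<Omega> \<and> smooth_on \<Omega> U \<and> U ` \<Omega> \<subseteq> states A \<longrightarrow>
        (\<forall>z\<in>\<Omega>. two_fluid_system_at A U z \<longleftrightarrow> dt U z + M (U z) *v dx U z = 0))"


section \<open>Symmetrizability and non-resonance\<close>

definition symmetric_matrix :: "real^'n^'n \<Rightarrow> bool" where
  "symmetric_matrix B \<longleftrightarrow> transpose B = B"

definition positive_definite :: "real^'n^'n \<Rightarrow> bool" where
  "positive_definite B \<longleftrightarrow> (\<forall>v. v \<noteq> 0 \<longrightarrow> v \<bullet> (B *v v) > 0)"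

definition symmetrizable_on :: "(real^'n) set \<Rightarrow> (real^'n \<Rightarrow> real^'n^'n) \<Rightarrow> bool" where
  "symmetrizable_on N M \<longleftrightarrow>
     (\<exists>P. smooth_on N P \<and>
        (\<forall>U\<in>N. symmetric_matrix (P U) \<and> positive_definite (P U) \<and>
                symmetric_matrix (P U ** M U)))"

definition non_resonant :: "(2 \<Rightarrow> eos) \<Rightarrow> state \<Rightarrow> bool" where
  "non_resonant A U \<longleftrightarrow>
     (\<forall>k. mix_vel A U \<noteq> vel U k + sound A U k \<and> mix_vel A U \<noteq> vel U k - sound A U k)"

end

theory Submission
  imports Defs
begin

text \<open>In the variables \<open>(\<alpha>\<^sub>1, u\<^sub>k, p\<^sub>k, s\<^sub>k)\<close> the balance laws reduce, for each phase, to an acoustic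
  block \<open>((u, 1/\<rho>), (\<rho> c\<^sup>2, u))\<close> in \<open>(u\<^sub>k, p\<^sub>k)\<close> and a scalar equation for \<open>s\<^sub>k\<close>, coupled to the
  transport of \<open>\<alpha>\<^sub>1\<close> with speed \<open>u\<close> only through a column \<open>b\<close>. The block is symmetrized by
  \<open>Q = diag (\<rho> c\<^sup>2, 1/\<rho>)\<close>. Bordering \<open>Q\<close> by a row and column \<open>w\<close> symmetrizes the full matrix iff
  \<open>(A\<^sup>T - u) w = Q b\<close>, which is solvable since \<open>u\<close> is not an eigenvalue \<open>u\<^sub>k \<plusminus> c\<^sub>k\<close> of the block; a
  large corner entry makes the bordered matrix positive definite. Smoothness in the state comes
  from the inverse function theorem for \<open>(\<tau>, e) \<mapsto> (p, s)\<close>, whose Jacobian determinant is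
  \<open>- \<rho>\<^sup>2 c\<^sup>2 / T\<close>.\<close>

section \<open>Smooth maps on open sets\<close>


text \<open>On an open set, agreement on \<open>S\<close> is agreement near each of its points, so
  the derivatives agree on \<open>S\<close> too and induction carries this to every order.\<close>

lemma times_cont_diff_on_cong:
  assumes "open S" "\<And>x. x \<in> S \<Longrightarrow> f x = g x"
  shows "times_cont_diff_on n S f \<longleftrightarrow> times_cont_diff_on n S g"
  using assms(2)
proof (induction n arbitrary: f g)
  case 0
  then show ?case by (simp cong: continuous_on_cong)
next
  case (Suc n)
  have diff: "f differentiable (at x) \<longleftrightarrow> g differentiable (at x)" if "x \<in> S" for x
    unfolding differentiable_def
    using that assms(1) Suc.prems
      has_derivative_transform_within_open[of f _ x UNIV S g]
      has_derivative_transform_within_open[of g _ x UNIV S f]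
    by auto
  show ?case
  proof (cases "\<forall>x\<in>S. f differentiable (at x)")
    case True
    then have "frechet_derivative f (at x) = frechet_derivative g (at x)" if "x \<in> S" for x
      using frechet_derivative_transform_within_open[of f x S g] that assms(1) Suc.prems by blast
    then have "times_cont_diff_on n S (\<lambda>x. frechet_derivative f (at x) v) \<longleftrightarrow>
        times_cont_diff_on n S (\<lambda>x. frechet_derivative g (at x) v)" for v
      by (intro Suc.IH) simp
    then show ?thesis
      using diff by simp
  next
    case False
    then show ?thesis
      using diff by auto
  qed
qed

text \<open>Lets an explicit derivative \<open>f'\<close> stand in for
  \<open>frechet_derivative\<close>. The two agree only on \<open>S\<close>, which the congruence
  rule absorbs.\<close>

lemma times_cont_diff_on_SucI:
  assumes "open S" "\<And>x. x \<in> S \<Longrightarrow> (f has_derivative f' x) (at x)"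
    and "\<And>v. times_cont_diff_on n S (\<lambda>x. f' x v)"
  shows "times_cont_diff_on (Suc n) S f"
proof -
  have "times_cont_diff_on n S (\<lambda>x. frechet_derivative f (at x) v)" for v
    using assms(3)[of v] frechet_derivative_at[OF assms(2)]
    by (subst times_cont_diff_on_cong[OF assms(1), where g = "\<lambda>x. f' x v"]) auto
  then show ?thesis
    using assms(2) by (auto simp: differentiable_def)
qed

lemma times_cont_diff_on_SucD:
  "times_cont_diff_on (Suc n) S f \<Longrightarrow> times_cont_diff_on n S f"
  by (induction n arbitrary: f)
    (auto intro!: differentiable_imp_continuous_on differentiable_at_imp_differentiable_on)

lemma times_cont_diff_on_Suc_has_derivative:
  "times_cont_diff_on (Suc n) S f \<Longrightarrow> x \<in> S \<Longrightarrow>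
    (f has_derivative frechet_derivative f (at x)) (at x)"
  by (simp add: frechet_derivative_works)

lemma times_cont_diff_on_const: "open S \<Longrightarrow> times_cont_diff_on n S (\<lambda>x. c)"
  by (induction n arbitrary: c) auto

lemma times_cont_diff_on_linear:
  assumes "open S" "bounded_linear L"
  shows "times_cont_diff_on n S L"
proof (cases n)
  case 0
  then show ?thesis
    using assms by (simp add: linear_continuous_on)
next
  case (Suc m)
  show ?thesis
    unfolding Suc using assms
    by (intro times_cont_diff_on_SucI[where f' = "\<lambda>x. L"] times_cont_diff_on_const)
      (auto intro: bounded_linear_imp_has_derivative)
qed

lemma times_cont_diff_on_add:
  assumes "open S" "times_cont_diff_on n S f" "times_cont_diff_on n S g"
  shows "times_cont_diff_on n S (\<lambda>x. f x + g x)"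
  using assms(2,3)
proof (induction n arbitrary: f g)
  case 0
  then show ?case by (simp add: continuous_on_add)
next
  case (Suc n)
  show ?case
    by (rule times_cont_diff_on_SucI[OF assms(1)
          has_derivative_add[OF times_cont_diff_on_Suc_has_derivative[OF Suc.prems(1)]
            times_cont_diff_on_Suc_has_derivative[OF Suc.prems(2)]]])
      (use Suc in auto)
qed

lemma times_cont_diff_on_linear_compose:
  assumes "open S" "bounded_linear L" "times_cont_diff_on n S f"
  shows "times_cont_diff_on n S (\<lambda>x. L (f x))"
  using assms(3)
proof (induction n arbitrary: f)
  case 0
  then show ?case
    using bounded_linear.continuous_on[OF assms(2)] by auto
next
  case (Suc n)
  show ?case
    by (rule times_cont_diff_on_SucI[OF assms(1)
          bounded_linear.has_derivative[OF assms(2)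
            times_cont_diff_on_Suc_has_derivative[OF Suc.prems]]])
      (use Suc in auto)
qed

text \<open>The product rule leaves a sum of products in which \<open>f\<close> and \<open>g\<close>
  occur again beside their derivatives; hence the induction over arbitrary \<open>f\<close>,
  \<open>g\<close> and the descent by \<open>times_cont_diff_on_SucD\<close>.\<close>

lemma times_cont_diff_on_scaleR:
  fixes f :: "'a::real_normed_vector \<Rightarrow> real"
  assumes "open S" "times_cont_diff_on n S f" "times_cont_diff_on n S g"
  shows "times_cont_diff_on n S (\<lambda>x. f x *\<^sub>R g x)"
  using assms(2,3)
proof (induction n arbitrary: f g)
  case 0
  then show ?case by (simp add: continuous_on_scaleR)
next
  case (Suc n)
  show ?case
  proof (rule times_cont_diff_on_SucI[OF assms(1)
          has_derivative_scaleR[OF times_cont_diff_on_Suc_has_derivative[OF Suc.prems(1)]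
            times_cont_diff_on_Suc_has_derivative[OF Suc.prems(2)]]], assumption, assumption)
    fix v
    show "times_cont_diff_on n S (\<lambda>x. f x *\<^sub>R frechet_derivative g (at x) v
        + frechet_derivative f (at x) v *\<^sub>R g x)"
      using Suc.prems Suc.prems[THEN times_cont_diff_on_SucD]
      by (intro times_cont_diff_on_add Suc.IH assms) auto
  qed
qed

lemma times_cont_diff_on_mult:
  fixes f g :: "'a::real_normed_vector \<Rightarrow> real"
  shows "open S \<Longrightarrow> times_cont_diff_on n S f \<Longrightarrow> times_cont_diff_on n S g \<Longrightarrow>
    times_cont_diff_on n S (\<lambda>x. f x * g x)"
  using times_cont_diff_on_scaleR[of S n f g] by simp

text \<open>\<open>1/f\<close> occurs in its own derivative, but there it is needed only one order
  lower, so the order can be raised step by step.\<close>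

lemma times_cont_diff_on_inverse:
  fixes f :: "'a::real_normed_vector \<Rightarrow> real"
  assumes "open S" "times_cont_diff_on n S f" "\<And>x. x \<in> S \<Longrightarrow> f x \<noteq> 0"
  shows "times_cont_diff_on n S (\<lambda>x. inverse (f x))"
  using assms(2)
proof (induction n)
  case 0
  then show ?case using assms(3) by (auto intro: continuous_on_inverse)
next
  case (Suc n)
  show ?case
  proof (rule times_cont_diff_on_SucI[OF assms(1)])
    show "((\<lambda>x. inverse (f x)) has_derivative
        (\<lambda>v. (- 1) * (inverse (f x) * (frechet_derivative f (at x) v * inverse (f x))))) (at x)"
      if "x \<in> S" for x
      by (rule has_derivative_eq_rhs[OF Deriv.has_derivative_inverse[OF assms(3)[OF that]
              times_cont_diff_on_Suc_has_derivative[OF Suc.prems that]]]) (simp add: mult.assoc)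
    show "times_cont_diff_on n S
        (\<lambda>x. (- 1) * (inverse (f x) * (frechet_derivative f (at x) v * inverse (f x))))" for v
    proof -
      have "times_cont_diff_on n S (\<lambda>x. frechet_derivative f (at x) v)"
        using Suc.prems by simp
      with Suc.IH[OF times_cont_diff_on_SucD[OF Suc.prems]] show ?thesis
        by (intro times_cont_diff_on_mult times_cont_diff_on_const assms(1))
    qed
  qed
qed

lemma times_cont_diff_on_sum:
  "open S \<Longrightarrow> (\<And>i. i \<in> I \<Longrightarrow> times_cont_diff_on n S (f i)) \<Longrightarrow>
    times_cont_diff_on n S (\<lambda>x. \<Sum>i\<in>I. f i x)"
  by (induction I rule: infinite_finite_induct)
    (simp_all add: times_cont_diff_on_const times_cont_diff_on_add)

text \<open>Order \<open>n + 1\<close> controls the derivative of \<open>f\<close> only in fixed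
  directions, whereas the chain rule applies it to a vector that varies with \<open>x\<close>.
  Expanding that vector in the basis of the Euclidean middle space leaves finitely many fixed
  directions with scalar coefficients of order \<open>n\<close>.\<close>

lemma times_cont_diff_on_compose:
  fixes g :: "'a::real_normed_vector \<Rightarrow> 'b::euclidean_space"
  assumes "open S" "open T" "g ` S \<subseteq> T" "times_cont_diff_on n S g" "times_cont_diff_on n T f"
  shows "times_cont_diff_on n S (\<lambda>x. f (g x))"
  using assms(4,5)
proof (induction n arbitrary: f)
  case 0
  then show ?case using assms(3) by (auto intro: continuous_on_compose2)
next
  case (Suc n)
  show ?case
  proof (rule times_cont_diff_on_SucI[OF assms(1)])
    fix x assume x: "x \<in> S"
    let ?f' = "frechet_derivative f (at (g x))" and ?g' = "frechet_derivative g (at x)"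
    have f': "(f has_derivative ?f') (at (g x))"
      using times_cont_diff_on_Suc_has_derivative[OF Suc.prems(2)] x assms(3) by blast
    have "?f' w = (\<Sum>b\<in>Basis. (w \<bullet> b) *\<^sub>R ?f' b)" for w
    proof -
      have "?f' w = ?f' (\<Sum>b\<in>Basis. (w \<bullet> b) *\<^sub>R b)"
        by (simp only: euclidean_representation)
      also have "\<dots> = (\<Sum>b\<in>Basis. (w \<bullet> b) *\<^sub>R ?f' b)"
        using has_derivative_linear[OF f'] by (simp add: linear_sum linear_cmul)
      finally show ?thesis .
    qed
    then have eq: "(\<lambda>v. ?f' (?g' v)) = (\<lambda>v. \<Sum>b\<in>Basis. (?g' v \<bullet> b) *\<^sub>R ?f' b)"
      by (rule ext)
    show "((\<lambda>x. f (g x)) has_derivative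
        (\<lambda>v. \<Sum>b\<in>Basis. (?g' v \<bullet> b) *\<^sub>R ?f' b)) (at x)"
      using has_derivative_compose[OF times_cont_diff_on_Suc_has_derivative[OF Suc.prems(1) x] f']
      unfolding eq .
  next
    fix v
    have "times_cont_diff_on n S (\<lambda>x. frechet_derivative f (at (g x)) b)" for b
      using Suc.prems times_cont_diff_on_SucD[OF Suc.prems(1)]
      by (intro Suc.IH[where f = "\<lambda>y. frechet_derivative f (at y) b"]) auto
    moreover have "times_cont_diff_on n S (\<lambda>x. frechet_derivative g (at x) v \<bullet> b)" for b
      using Suc.prems(1)
      by (intro times_cont_diff_on_linear_compose[OF assms(1) bounded_linear_inner_left]) auto
    ultimately show "times_cont_diff_on n S (\<lambda>x. \<Sum>b\<in>Basis.
        (frechet_derivative g (at x) v \<bullet> b) *\<^sub>R frechet_derivative f (at (g x)) b)"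
      by (intro times_cont_diff_on_sum times_cont_diff_on_scaleR assms(1))
  qed
qed

lemma times_cont_diff_on_subset:
  "times_cont_diff_on n T f \<Longrightarrow> S \<subseteq> T \<Longrightarrow> times_cont_diff_on n S f"
  by (induction n arbitrary: f) (auto intro: continuous_on_subset)

section \<open>Closure properties of smooth maps\<close>

lemma smooth_on_subset: "smooth_on T f \<Longrightarrow> S \<subseteq> T \<Longrightarrow> smooth_on S f"
  unfolding smooth_on_def using times_cont_diff_on_subset by blast

lemma smooth_on_cong:
  "open S \<Longrightarrow> (\<And>x. x \<in> S \<Longrightarrow> f x = g x) \<Longrightarrow> smooth_on S f \<longleftrightarrow> smooth_on S g"
  unfolding smooth_on_def using times_cont_diff_on_cong by blast

lemma smooth_on_frechet_derivative:
  "smooth_on S f \<Longrightarrow> smooth_on S (\<lambda>x. frechet_derivative f (at x) v)"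
  unfolding smooth_on_def by (metis times_cont_diff_on.simps(2))

lemma smooth_on_has_derivative:
  "smooth_on S f \<Longrightarrow> x \<in> S \<Longrightarrow> (f has_derivative frechet_derivative f (at x)) (at x)"
  unfolding smooth_on_def using times_cont_diff_on_Suc_has_derivative by blast

lemma smooth_on_imp_continuous_on: "smooth_on S f \<Longrightarrow> continuous_on S f"
  unfolding smooth_on_def by (metis times_cont_diff_on.simps(1))

lemma smooth_on_const: "open S \<Longrightarrow> smooth_on S (\<lambda>x. c)"
  by (simp add: smooth_on_def times_cont_diff_on_const)

lemma smooth_on_linear: "open S \<Longrightarrow> bounded_linear L \<Longrightarrow> smooth_on S L"
  by (simp add: smooth_on_def times_cont_diff_on_linear)

lemma smooth_on_fst: "open S \<Longrightarrow> smooth_on S fst"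
  by (rule smooth_on_linear[OF _ bounded_linear_fst])

lemma smooth_on_linear_compose:
  "open S \<Longrightarrow> bounded_linear L \<Longrightarrow> smooth_on S f \<Longrightarrow> smooth_on S (\<lambda>x. L (f x))"
  by (simp add: smooth_on_def times_cont_diff_on_linear_compose)

lemma smooth_on_add:
  "open S \<Longrightarrow> smooth_on S f \<Longrightarrow> smooth_on S g \<Longrightarrow> smooth_on S (\<lambda>x. f x + g x)"
  by (simp add: smooth_on_def times_cont_diff_on_add)

lemma smooth_on_minus: "open S \<Longrightarrow> smooth_on S f \<Longrightarrow> smooth_on S (\<lambda>x. - f x)"
  using smooth_on_linear_compose[OF _ bounded_linear_minus[OF bounded_linear_ident]] .

lemma smooth_on_diff:
  "open S \<Longrightarrow> smooth_on S f \<Longrightarrow> smooth_on S g \<Longrightarrow> smooth_on S (\<lambda>x. f x - g x)"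
  using smooth_on_add[OF _ _ smooth_on_minus, of S f g] by simp

lemma smooth_on_sum:
  "open S \<Longrightarrow> (\<And>i. i \<in> I \<Longrightarrow> smooth_on S (f i)) \<Longrightarrow> smooth_on S (\<lambda>x. \<Sum>i\<in>I. f i x)"
  by (simp add: smooth_on_def times_cont_diff_on_sum)

lemma smooth_on_mult:
  fixes f g :: "'a::real_normed_vector \<Rightarrow> real"
  shows "open S \<Longrightarrow> smooth_on S f \<Longrightarrow> smooth_on S g \<Longrightarrow> smooth_on S (\<lambda>x. f x * g x)"
  by (simp add: smooth_on_def times_cont_diff_on_mult)

lemma smooth_on_power:
  fixes f :: "'a::real_normed_vector \<Rightarrow> real"
  shows "open S \<Longrightarrow> smooth_on S f \<Longrightarrow> smooth_on S (\<lambda>x. f x ^ n)"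
  by (induction n) (auto intro: smooth_on_const smooth_on_mult)

lemma smooth_on_divide:
  fixes f g :: "'a::real_normed_vector \<Rightarrow> real"
  assumes "open S" "smooth_on S f" "smooth_on S g" "\<And>x. x \<in> S \<Longrightarrow> g x \<noteq> 0"
  shows "smooth_on S (\<lambda>x. f x / g x)"
  using assms by (auto simp: smooth_on_def divide_inverse
      intro!: times_cont_diff_on_mult times_cont_diff_on_inverse)

lemma smooth_on_compose:
  fixes g :: "'a::real_normed_vector \<Rightarrow> 'b::euclidean_space"
  assumes "smooth_on T f" "smooth_on S g" "open S" "open T" "g ` S \<subseteq> T"
  shows "smooth_on S (\<lambda>x. f (g x))"
  using assms times_cont_diff_on_compose unfolding smooth_on_def by blast

lemma smooth_on_vec_lambda:
  fixes f :: "'a::real_normed_vector \<Rightarrow> 'b::real_normed_vector ^ 'n"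
  assumes "open S" "\<And>i. smooth_on S (\<lambda>x. f x $ i)"
  shows "smooth_on S f"
proof -
  have "bounded_linear (axis i :: 'b \<Rightarrow> 'b ^ 'n)" for i
    by (rule bounded_linear_intro[where K = 1])
      (auto simp: axis_def vec_eq_iff norm_vec_def L2_set_def if_distrib if_distribR cong: if_cong)
  then have "smooth_on S (\<lambda>x. \<Sum>i\<in>UNIV. axis i (f x $ i))"
    using assms by (intro smooth_on_sum smooth_on_linear_compose[where L = "axis _"]) auto
  moreover have "(\<Sum>i\<in>UNIV. axis i (f x $ i)) = f x" for x
    by (simp add: vec_eq_iff axis_def if_distrib if_distribR cong: if_cong)
  ultimately show ?thesis by simp
qed

lemma smooth_on_Pair:
  assumes "open S" "smooth_on S f" "smooth_on S g"
  shows "smooth_on S (\<lambda>x. (f x, g x))"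
proof -
  have "smooth_on S (\<lambda>x. (f x, 0) + (0, g x))"
    using assms
    by (intro smooth_on_add smooth_on_linear_compose[where L = "\<lambda>x. (x, 0)"]
        smooth_on_linear_compose[where L = "\<lambda>x. (0, x)"])
      (auto intro!: bounded_linear_Pair bounded_linear_ident bounded_linear_zero)
  then show ?thesis by simp
qed

text \<open>A global form of the inverse function theorem. Injectivity is assumed and invariance of
  domain makes the image open. The derivative of the inverse is \<open>g'\<close> evaluated at the
  inverse itself, so each order of differentiability of the inverse yields the next.\<close>

lemma
  fixes f :: "'a::euclidean_space \<Rightarrow> 'a"
  assumes "open S" "inj_on f S" "smooth_on S f"
    and f': "\<And>x. x \<in> S \<Longrightarrow> (f has_derivative f' x) (at x)"
    and inv: "\<And>x v. x \<in> S \<Longrightarrow> f' x (g' x v) = v"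
    and g': "\<And>v. smooth_on S (\<lambda>x. g' x v)"
  shows open_image_inj_smooth_on: "open (f ` S)"
    and has_derivative_inv_into:
      "\<And>x. x \<in> S \<Longrightarrow> (inv_into S f has_derivative g' x) (at (f x))"
    and smooth_on_inv_into: "smooth_on (f ` S) (inv_into S f)"
proof -
  let ?g = "inv_into S f"
  have cont: "continuous_on S f"
    using assms by (simp add: smooth_on_imp_continuous_on)
  show o: "open (f ` S)"
    using invariance_of_domain[OF cont assms(1,2)] .
  show d: "(?g has_derivative g' x) (at (f x))" if "x \<in> S" for x
    using assms that by (intro has_derivative_inverse_strong[OF _ _ cont _ f']) auto
  have "times_cont_diff_on n (f ` S) ?g" for n
  proof (induction n)
    case 0
    have "?g differentiable (at y)" if "y \<in> f ` S" for y
      using d that by (auto simp: differentiable_def)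
    then show ?case
      by (simp add: differentiable_imp_continuous_on differentiable_at_imp_differentiable_on)
  next
    case (Suc n)
    show ?case
    proof (rule times_cont_diff_on_SucI[OF o])
      show "(?g has_derivative g' (?g y)) (at y)" if "y \<in> f ` S" for y
        using d that assms(2) by auto
      show "times_cont_diff_on n (f ` S) (\<lambda>y. g' (?g y) v)" for v
        using g' assms
        by (intro times_cont_diff_on_compose[OF o assms(1) _ Suc.IH])
          (auto simp: smooth_on_def)
    qed
  qed
  then show "smooth_on (f ` S) ?g"
    by (simp add: smooth_on_def)
qed

section \<open>Equations of state\<close>


text \<open>Concavity bounds the difference quotients along the segment from below; their limit at
  \<open>x\<close> is the weak tangent inequality \<open>le\<close>.\<close>

lemma strictly_concave_on_less_tangent:
  assumes conc: "strictly_concave_on S f" and D: "(f has_derivative D) (at x)"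
    and S: "x \<in> S" "y \<in> S" "x \<noteq> y"
  shows "f y < f x + D (y - x)"
proof -
  have le: "f z - f x \<le> D (z - x)" if z: "z \<in> S" "z \<noteq> x" for z
  proof -
    let ?\<phi> = "\<lambda>t::real. f (x + t *\<^sub>R (z - x))"
    have "((\<lambda>t. x + t *\<^sub>R (z - x)) has_derivative (\<lambda>t. t *\<^sub>R (z - x))) (at 0)"
      by (auto intro!: derivative_eq_intros)
    moreover have "(f has_derivative D) (at (x + 0 *\<^sub>R (z - x)))"
      using D by simp
    ultimately have "(?\<phi> has_derivative (\<lambda>t. D (t *\<^sub>R (z - x)))) (at 0)"
      by (rule has_derivative_compose)
    then have "(?\<phi> has_real_derivative D (z - x)) (at 0)"
      using has_derivative_linear[OF D]
      by (simp add: has_field_derivative_def linear_cmul mult_commute_abs)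
    then have "((\<lambda>t. (?\<phi> t - ?\<phi> 0) / (t - 0)) \<longlongrightarrow> D (z - x)) (at 0)"
      unfolding has_field_derivative_iff by simp
    then have lim: "((\<lambda>t. (?\<phi> t - f x) / t) \<longlongrightarrow> D (z - x)) (at_right 0)"
      using tendsto_mono[OF at_le[OF subset_UNIV]] by simp
    have "\<forall>\<^sub>F t in at_right 0. f z - f x \<le> (?\<phi> t - f x) / t"
    proof (rule eventually_at_rightI[of 0 1])
      fix t :: real assume t: "t \<in> {0<..<1}"
      then have "(1 - t) * f x + t * f z < f ((1 - t) *\<^sub>R x + t *\<^sub>R z)"
        using conc S z unfolding strictly_concave_on_def by auto
      also have "(1 - t) *\<^sub>R x + t *\<^sub>R z = x + t *\<^sub>R (z - x)"
        by (simp add: algebra_simps)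
      finally show "f z - f x \<le> (?\<phi> t - f x) / t"
        using t by (simp add: field_simps)
    qed simp
    with lim show ?thesis
      by (rule tendsto_lowerbound) simp
  qed
  \<comment> \<open>The limit has lost strictness. It is recovered at the midpoint: \<open>f\<close>
    lies strictly above the chord there, while \<open>le\<close> still bounds it by the
    tangent.\<close>
  let ?m = "(1 - 1/2) *\<^sub>R x + (1/2) *\<^sub>R y"
  have *: "(1 - 1/2) * f x + 1/2 * f y < f ?m"
    using conc[unfolded strictly_concave_on_def, THEN conjunct2, rule_format, of x y "1/2"] S
    by simp
  have m: "?m - x = (1/2) *\<^sub>R (y - x)"
    by (simp add: algebra_simps flip: scaleR_add_left)
  have "?m \<in> S"
    using conc S convexD[of S x y "1/2" "1/2"] unfolding strictly_concave_on_def by simp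
  moreover have "?m \<noteq> x"
    using m S(3) by auto
  ultimately have "f ?m - f x \<le> D ((1/2) *\<^sub>R (y - x))"
    using le m by metis
  then show ?thesis
    using * has_derivative_linear[OF D] by (simp add: linear_cmul)
qed

text \<open>The squared sound speed in the variables \<open>(\<tau>, e)\<close>: along an isentrope \<open>de = - p d\<tau>\<close>
  and \<open>d\<rho> = - d\<tau> / \<tau>\<^sup>2\<close>.\<close>

definition sound_sq :: "eos \<Rightarrow> real \<times> real \<Rightarrow> real" where
  "sound_sq A x = - (fst x)\<^sup>2 * frechet_derivative (pressure A) (at x) (1, - pressure A x)"

text \<open>The derivative of the inverse of \<open>ps_map\<close>, from \<open>dp = - (c / \<tau>)\<^sup>2 d\<tau> + (\<partial>p/\<partial>e) T ds\<close> and
  \<open>de = T ds - p d\<tau>\<close>.\<close>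

definition ps_inv_deriv :: "eos \<Rightarrow> real \<times> real \<Rightarrow> real \<times> real \<Rightarrow> real \<times> real" where
  "ps_inv_deriv A x v =
    (let d\<tau> = (fst x)\<^sup>2 / sound_sq A x *
           (frechet_derivative (pressure A) (at x) (0, 1) * temperature A x * snd v - fst v)
     in (d\<tau>, temperature A x * snd v - pressure A x * d\<tau>))"

context
  fixes A :: eos
  assumes eos: "complete_eos A"
begin

lemma open_eos_dom: "open (eos_dom A)"
  and fst_eos_dom_pos: "x \<in> eos_dom A \<Longrightarrow> fst x > 0"
  and smooth_on_entropy: "smooth_on (eos_dom A) (entropy A)"
  and temperature_pos: "x \<in> eos_dom A \<Longrightarrow> temperature A x > 0"
  and sound_speed_pos: "x \<in> eos_dom A \<Longrightarrow> sound_speed A x > 0"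
  using eos unfolding complete_eos_def by auto

lemma smooth_on_temperature: "smooth_on (eos_dom A) (temperature A)"
proof -
  have "frechet_derivative (entropy A) (at x) (0, 1) \<noteq> 0" if "x \<in> eos_dom A" for x
    using temperature_pos[OF that] by (auto simp: temperature_def)
  then show ?thesis
    unfolding temperature_def[abs_def]
    by (intro smooth_on_divide smooth_on_const smooth_on_frechet_derivative open_eos_dom
        smooth_on_entropy)
qed

lemma smooth_on_pressure: "smooth_on (eos_dom A) (pressure A)"
  unfolding pressure_def[abs_def]
  by (intro smooth_on_mult smooth_on_temperature smooth_on_frechet_derivative open_eos_dom
      smooth_on_entropy)

text \<open>The Gibbs identity solved for \<open>ds\<close>.\<close>

lemma entropy_has_derivative:
  assumes "x \<in> eos_dom A"
  shows "(entropy A has_derivative (\<lambda>v. (snd v + pressure A x * fst v) / temperature A x)) (at x)"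
proof -
  have D: "(entropy A has_derivative frechet_derivative (entropy A) (at x)) (at x)"
    using smooth_on_has_derivative[OF smooth_on_entropy assms] .
  then have "frechet_derivative (entropy A) (at x)
      = (\<lambda>v. (snd v + pressure A x * fst v) / temperature A x)"
    using gibbs_identity[OF differentiableI[OF D] temperature_pos[OF assms]]
      temperature_pos[OF assms]
    by (auto simp: eq_divide_eq mult.commute[of _ "temperature A x"])
  with D show ?thesis by (simp only:)
qed

lemma pressure_has_derivative:
  assumes "x \<in> eos_dom A"
  shows "(pressure A has_derivative frechet_derivative (pressure A) (at x)) (at x)"
  using smooth_on_has_derivative[OF smooth_on_pressure assms] .

text \<open>Splits a direction into its isentropic part along \<open>(1, -p)\<close>, where the
  pressure changes by \<open>-(c/\<tau>)\<^sup>2 d\<tau>\<close>, and a pure energy part of size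
  \<open>de + p d\<tau> = T ds\<close>.\<close>

lemma frechet_derivative_pressure:
  assumes "x \<in> eos_dom A"
  shows "frechet_derivative (pressure A) (at x) (a, b)
    = - (sound_sq A x / (fst x)\<^sup>2) * a
      + frechet_derivative (pressure A) (at x) (0, 1) * (b + pressure A x * a)"
proof -
  let ?D = "frechet_derivative (pressure A) (at x)"
  have lin: "linear ?D"
    using has_derivative_linear[OF pressure_has_derivative[OF assms]] .
  have "(a, b) = a *\<^sub>R (1, - pressure A x) + (b + pressure A x * a) *\<^sub>R (0, 1)"
    by simp
  then have "?D (a, b) = a * ?D (1, - pressure A x) + (b + pressure A x * a) * ?D (0, 1)"
    using lin by (simp only: linear_add linear_cmul real_scaleR_def)
  then show ?thesis
    using fst_eos_dom_pos[OF assms] by (simp add: sound_sq_def)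
qed

text \<open>The direction \<open>(1, -p)\<close> in \<open>sound_sq\<close> depends on the point, so
  linearity is used first to reduce to derivatives in the fixed directions \<open>(1, 0)\<close> and
  \<open>(0, 1)\<close>.\<close>

lemma smooth_on_sound_sq: "smooth_on (eos_dom A) (sound_sq A)"
proof -
  let ?D = "\<lambda>v x. frechet_derivative (pressure A) (at x) v"
  let ?f = "\<lambda>x. - (fst x)\<^sup>2 * (?D (1, 0) x - pressure A x * ?D (0, 1) x)"
  have "smooth_on (eos_dom A) ?f"
    by (intro smooth_on_mult smooth_on_minus smooth_on_power smooth_on_diff open_eos_dom
        smooth_on_pressure smooth_on_frechet_derivative smooth_on_fst)
  moreover have "?f x = sound_sq A x" if "x \<in> eos_dom A" for x
  proof -
    have "?D (1, 0) x - pressure A x * ?D (0, 1) x = - (sound_sq A x / (fst x)\<^sup>2)"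
      using frechet_derivative_pressure[OF that, of 1 0] by simp
    then show ?thesis
      using fst_eos_dom_pos[OF that] by simp
  qed
  ultimately show ?thesis
    using smooth_on_cong[OF open_eos_dom, of ?f "sound_sq A"] by blast
qed

text \<open>Both tangent inequalities between two points of equal entropy involve \<open>de + p d\<tau>\<close>, with
  opposite signs and the two respective pressures.\<close>

lemma eos_dom_eqI:
  assumes "x \<in> eos_dom A" "y \<in> eos_dom A" "entropy A x = entropy A y"
    and "pressure A x = pressure A y \<or> fst x = fst y"
  shows "x = y"
proof (rule ccontr)
  assume "x \<noteq> y"
  have "strictly_concave_on (eos_dom A) (entropy A)"
    using eos unfolding complete_eos_def by auto
  note * = strictly_concave_on_less_tangent[OF this entropy_has_derivative]
  have "0 < snd (y - x) + pressure A x * fst (y - x)"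
    using *[OF assms(1,1,2) \<open>x \<noteq> y\<close>] assms(3) temperature_pos[OF assms(1)]
    by (simp add: zero_less_divide_iff)
  moreover have "0 < snd (x - y) + pressure A y * fst (x - y)"
    using *[OF assms(2,2,1)] \<open>x \<noteq> y\<close> assms(3) temperature_pos[OF assms(2)]
    by (simp add: zero_less_divide_iff)
  ultimately show False
    using assms(4) by (auto simp: algebra_simps)
qed

text \<open>The isentrope is a coordinate line of the chart
  \<open>(\<tau>, e) \<mapsto> (\<tau>, s)\<close>. Inverting this chart by the inverse function
  theorem turns the implicitly described energy into a differentiable function of the
  density.\<close>

lemma isentrope_pressure_has_derivative:
  assumes x: "x \<in> eos_dom A"
  shows "((\<lambda>\<rho>. pressure A (1 / \<rho>, isentrope_energy A (entropy A x) (1 / \<rho>)))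
    has_real_derivative sound_sq A x) (at (1 / fst x))"
proof -
  define \<Phi> where "\<Phi> z = (fst z, entropy A z)" for z
  define G where "G = inv_into (eos_dom A) \<Phi>"
  \<comment> \<open>The inverse of the derivative of \<open>\<Phi>\<close>: \<open>d\<tau>\<close>
    is kept and \<open>de = T ds - p d\<tau>\<close>.\<close>
  let ?g' = "\<lambda>z v. (fst v, temperature A z * snd v - pressure A z * fst v)"
  note pos = fst_eos_dom_pos[OF x]
  have inj: "inj_on \<Phi> (eos_dom A)"
    using eos_dom_eqI by (auto simp: inj_on_def \<Phi>_def)
  have sm: "smooth_on (eos_dom A) \<Phi>"
    unfolding \<Phi>_def
    by (intro smooth_on_Pair open_eos_dom smooth_on_entropy smooth_on_fst)
  have d\<Phi>: "(\<Phi> has_derivative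
      (\<lambda>v. (fst v, (snd v + pressure A z * fst v) / temperature A z))) (at z)"
    if "z \<in> eos_dom A" for z
    unfolding \<Phi>_def
    by (intro has_derivative_Pair entropy_has_derivative that has_derivative_fst
        has_derivative_ident)
  have inv: "(fst (?g' z v), (snd (?g' z v) + pressure A z * fst (?g' z v)) / temperature A z) = v"
    if "z \<in> eos_dom A" for z v
    using temperature_pos[OF that] by (simp add: prod_eq_iff)
  have smg: "smooth_on (eos_dom A) (\<lambda>z. ?g' z v)" for v
    by (intro smooth_on_Pair smooth_on_const smooth_on_diff smooth_on_mult open_eos_dom
        smooth_on_temperature smooth_on_pressure)
  note * = open_eos_dom inj sm d\<Phi> inv smg
  have op: "open (\<Phi> ` eos_dom A)"
    by (rule open_image_inj_smooth_on[OF *])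
  have dG: "(G has_derivative ?g' x) (at (fst x, entropy A x))"
    unfolding G_def using has_derivative_inv_into[OF *, of x] x by (simp add: \<Phi>_def)
  have Gx: "G (fst x, entropy A x) = x"
    unfolding G_def using inv_into_f_f[OF inj x] by (simp add: \<Phi>_def)
  let ?h = "\<lambda>\<rho>. (1 / \<rho>, entropy A x)"
  have h: "(?h has_derivative (\<lambda>h. (- (fst x)\<^sup>2 * h, 0))) (at (1 / fst x))"
    using pos by (auto intro!: derivative_eq_intros simp: field_simps power2_eq_square)
  have "(G has_derivative ?g' x) (at (?h (1 / fst x)))"
    using dG by simp
  moreover have "(pressure A has_derivative frechet_derivative (pressure A) (at x))
      (at (G (?h (1 / fst x))))"
    using pressure_has_derivative[OF x] Gx by simp
  ultimately have "((\<lambda>\<rho>. pressure A (G (?h \<rho>))) has_derivative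
      (\<lambda>h. frechet_derivative (pressure A) (at x) (?g' x (- (fst x)\<^sup>2 * h, 0)))) (at (1 / fst x))"
    by (rule has_derivative_compose[OF has_derivative_compose[OF h]])
  then have D: "((\<lambda>\<rho>. pressure A (G (?h \<rho>))) has_real_derivative sound_sq A x) (at (1 / fst x))"
    unfolding has_field_derivative_def
  proof (rule has_derivative_eq_rhs, intro ext)
    show "frechet_derivative (pressure A) (at x) (?g' x (- (fst x)\<^sup>2 * h, 0)) = sound_sq A x * h" for h
      using pos by (subst frechet_derivative_pressure[OF x]) simp
  qed
  have eq: "(1 / \<rho>, isentrope_energy A (entropy A x) (1 / \<rho>)) = G (?h \<rho>)"
    if "?h \<rho> \<in> \<Phi> ` eos_dom A" for \<rho>
  proof -
    obtain y where y: "y \<in> eos_dom A" "fst y = 1 / \<rho>" "entropy A y = entropy A x"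
      using \<open>?h \<rho> \<in> _\<close> by (auto simp: \<Phi>_def)
    have Gy: "G (?h \<rho>) = y"
      unfolding G_def using inv_into_f_f[OF inj y(1)] y by (simp add: \<Phi>_def)
    have "isentrope_energy A (entropy A x) (1 / \<rho>) = snd y"
      unfolding isentrope_energy_def
    proof (rule the_equality)
      show "(1 / \<rho>, snd y) \<in> eos_dom A \<and> entropy A (1 / \<rho>, snd y) = entropy A x"
        using y by (metis prod.collapse)
      fix e assume "(1 / \<rho>, e) \<in> eos_dom A \<and> entropy A (1 / \<rho>, e) = entropy A x"
      then show "e = snd y"
        using eos_dom_eqI[of "(1 / \<rho>, e)" y] y by auto
    qed
    then show ?thesis
      using Gy y by (simp add: prod_eq_iff)
  qed
  \<comment> \<open>The description of the isentrope by \<open>G\<close> is valid only while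
    \<open>?h \<rho>\<close> lies in the image of \<open>\<Phi>\<close>. That image is open, so it
    is valid near the base point, which is enough for the derivative.\<close>
  have "?h (1 / fst x) \<in> \<Phi> ` eos_dom A"
    using x by (auto simp: \<Phi>_def)
  moreover have "isCont ?h (1 / fst x)"
    using has_derivative_continuous[OF h] .
  ultimately have "\<forall>\<^sub>F \<rho> in nhds (1 / fst x). ?h \<rho> \<in> \<Phi> ` eos_dom A"
    by (simp add: continuous_at_open eventually_nhds) (metis op)
  then have "\<forall>\<^sub>F \<rho> in nhds (1 / fst x). pressure A (G (?h \<rho>))
      = pressure A (1 / \<rho>, isentrope_energy A (entropy A x) (1 / \<rho>))"
    by eventually_elim (simp add: eq)
  from DERIV_cong_ev[OF refl this refl] D show ?thesis
    by simp
qed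

text \<open>\<open>sound_speed\<close> is \<open>sqrt\<close> of \<open>sound_sq\<close>. Since
  \<open>sqrt\<close> is negative on negative reals, its positivity forces the radicand to be
  positive, and squaring then undoes the root.\<close>

lemma
  assumes "x \<in> eos_dom A"
  shows sound_speed_sq: "(sound_speed A x)\<^sup>2 = sound_sq A x"
    and sound_sq_pos: "sound_sq A x > 0"
  using sound_speed_pos[OF assms] DERIV_imp_deriv[OF isentrope_pressure_has_derivative[OF assms]]
  by (simp_all add: sound_speed_def)

section \<open>The change of variables from \<open>(\<tau>, e)\<close> to
  \<open>(p, s)\<close>\<close>

lemma inj_on_ps_map: "inj_on (ps_map A) (eos_dom A)"
  using eos_dom_eqI by (auto simp: inj_on_def ps_map_def)

lemma
  shows open_ps_map_image: "open (ps_map A ` eos_dom A)"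
    and ps_map_inv_has_derivative: "x \<in> eos_dom A \<Longrightarrow>
      (inv_into (eos_dom A) (ps_map A) has_derivative ps_inv_deriv A x) (at (ps_map A x))"
    and smooth_on_ps_map_inv:
      "smooth_on (ps_map A ` eos_dom A) (inv_into (eos_dom A) (ps_map A))"
proof -
  let ?f' = "\<lambda>x v. (frechet_derivative (pressure A) (at x) v,
    (snd v + pressure A x * fst v) / temperature A x)"
  have 1: "smooth_on (eos_dom A) (ps_map A)"
    unfolding ps_map_def[abs_def]
    by (intro smooth_on_Pair open_eos_dom smooth_on_entropy smooth_on_pressure)
  have 2: "(ps_map A has_derivative ?f' x) (at x)" if "x \<in> eos_dom A" for x
    unfolding ps_map_def[abs_def]
    by (intro has_derivative_Pair entropy_has_derivative pressure_has_derivative that)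
  \<comment> \<open>Here the positive sound speed enters: the Jacobian of \<open>ps_map\<close> is
    invertible because \<open>sound_sq\<close> is nonzero.\<close>
  have 3: "?f' x (ps_inv_deriv A x v) = v" if x: "x \<in> eos_dom A" for x v
    using temperature_pos[OF x] fst_eos_dom_pos[OF x] sound_sq_pos[OF x]
    by (simp add: ps_inv_deriv_def Let_def prod_eq_iff)
      (subst frechet_derivative_pressure[OF x], simp)
  have "sound_sq A x \<noteq> 0" if "x \<in> eos_dom A" for x
    using sound_sq_pos[OF that] by simp
  then have 4: "smooth_on (eos_dom A) (\<lambda>x. ps_inv_deriv A x v)" for v
    unfolding ps_inv_deriv_def Let_def
    by (intro smooth_on_Pair smooth_on_const smooth_on_diff smooth_on_mult smooth_on_divide
        smooth_on_power open_eos_dom smooth_on_temperature smooth_on_pressure smooth_on_sound_sq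
        smooth_on_frechet_derivative smooth_on_fst)
  note * = open_eos_dom inj_on_ps_map 1 2 3 4
  show "open (ps_map A ` eos_dom A)"
    by (rule open_image_inj_smooth_on[where f' = ?f' and g' = "ps_inv_deriv A", OF *])
  show "(inv_into (eos_dom A) (ps_map A) has_derivative ps_inv_deriv A x) (at (ps_map A x))"
    if "x \<in> eos_dom A"
    by (rule has_derivative_inv_into[where f' = ?f' and g' = "ps_inv_deriv A", OF *])
      (simp_all add: that)
  show "smooth_on (ps_map A ` eos_dom A) (inv_into (eos_dom A) (ps_map A))"
    by (rule smooth_on_inv_into[where f' = ?f' and g' = "ps_inv_deriv A", OF *])
qed

end

section \<open>Arrow-shaped matrices\<close>


lemma exhaust_7:
  fixes x :: 7
  shows "x = 1 \<or> x = 2 \<or> x = 3 \<or> x = 4 \<or> x = 5 \<or> x = 6 \<or> x = 7"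
proof (induct x)
  case (of_int z)
  then have "0 \<le> z" and "z < 7" by simp_all
  then have "z = 0 \<or> z = 1 \<or> z = 2 \<or> z = 3 \<or> z = 4 \<or> z = 5 \<or> z = 6" by arith
  then show ?case by auto
qed

lemma forall_7: "(\<forall>i::7. P i) \<longleftrightarrow> P 1 \<and> P 2 \<and> P 3 \<and> P 4 \<and> P 5 \<and> P 6 \<and> P 7"
  by (metis exhaust_7)

lemma sum_7: "sum f (UNIV::7 set) = f 1 + f 2 + f 3 + f 4 + f 5 + f 6 + f 7"
proof -
  have *: "UNIV = {1, 2, 3, 4, 5, 6, 7::7}"
    using exhaust_7 by auto
  show ?thesis
    unfolding * by (simp add: add.assoc)
qed

text \<open>Families indexed by the phase let one formula serve both phases; the coordinates are
  placed where \<open>vel\<close>, \<open>pres\<close> and \<open>entr\<close> read them.\<close>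

definition state_vec ::
  "real \<Rightarrow> (2 \<Rightarrow> real) \<Rightarrow> (2 \<Rightarrow> real) \<Rightarrow> (2 \<Rightarrow> real) \<Rightarrow> state" where
  "state_vec a f g h = (\<chi> i. if i = 1 then a else if i = 2 then f 1 else if i = 3 then g 1
     else if i = 4 then h 1 else if i = 5 then f 2 else if i = 6 then g 2 else h 2)"

lemma state_vec_simps [simp]:
  "state_vec a f g h $ 1 = a" "vel (state_vec a f g h) k = f k"
  "pres (state_vec a f g h) k = g k" "entr (state_vec a f g h) k = h k"
  using exhaust_2[of k] by (auto simp: state_vec_def vel_def pres_def entr_def)

lemma linear_components [simp]:
  "vel (x + y) k = vel x k + vel y k" "vel (c *\<^sub>R x) k = c * vel x k" "vel 0 k = 0"
  "pres (x + y) k = pres x k + pres y k" "pres (c *\<^sub>R x) k = c * pres x k" "pres 0 k = 0"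
  "entr (x + y) k = entr x k + entr y k" "entr (c *\<^sub>R x) k = c * entr x k" "entr 0 k = 0"
  by (auto simp: vel_def pres_def entr_def)

lemma bounded_linear_components:
  "bounded_linear (\<lambda>x. vel x k)" "bounded_linear (\<lambda>x. pres x k)" "bounded_linear (\<lambda>x. entr x k)"
  by (auto intro!: linearI simp: linear_conv_bounded_linear[symmetric])

lemma state_eq_iff:
  "x = y \<longleftrightarrow> x $ 1 = y $ 1 \<and> (\<forall>k. vel x k = vel y k \<and> pres x k = pres y k \<and> entr x k = entr y k)"
  by (auto simp: vec_eq_iff forall_7 forall_2 vel_def pres_def entr_def)

lemma inner_state:
  "x \<bullet> y = x $ 1 * y $ 1 + (\<Sum>k\<in>UNIV. vel x k * vel y k + pres x k * pres y k + entr x k * entr y k)"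
  by (simp add: inner_vec_def sum_7 sum_2 vel_def pres_def entr_def)

text \<open>Allows symmetry to be checked as symmetry of a bilinear form, without listing the 49
  entries.\<close>

lemma symmetric_matrixI:
  fixes f :: "real^'n \<Rightarrow> real^'n"
  assumes "linear f" "\<And>x y. y \<bullet> f x = x \<bullet> f y"
  shows "symmetric_matrix (matrix f)"
proof -
  have "matrix f $ i $ j = matrix f $ j $ i" for i j
    using assms(2)[of "axis i 1" "axis j 1"] by (simp add: matrix_def inner_axis' inner_axis)
  then show ?thesis
    by (simp add: symmetric_matrix_def transpose_def vec_eq_iff)
qed

text \<open>Both matrices couple the two phases only through the volume fraction; \<open>r\<close> stands for
  \<open>1/\<rho>\<close> and \<open>\<kappa>\<close> for \<open>\<rho> c\<^sup>2\<close>.\<close>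

definition transport_map ::
  "real \<Rightarrow> (2 \<Rightarrow> real) \<Rightarrow> (2 \<Rightarrow> real) \<Rightarrow> (2 \<Rightarrow> real) \<Rightarrow> (2 \<Rightarrow> real) \<Rightarrow> (2 \<Rightarrow> real) \<Rightarrow> state \<Rightarrow> state"
  where
  "transport_map v b c u r \<kappa> x = state_vec (v * x $ 1)
     (\<lambda>k. b k * x $ 1 + u k * vel x k + r k * pres x k)
     (\<lambda>k. c k * x $ 1 + \<kappa> k * vel x k + u k * pres x k)
     (\<lambda>k. u k * entr x k)"

text \<open>The corner entry is chosen so that the Schur complement of the diagonal block
  \<open>diag (\<kappa>, r, 1)\<close> of the two phases is exactly 1.\<close>

definition symmetrizer_map ::
  "(2 \<Rightarrow> real) \<Rightarrow> (2 \<Rightarrow> real) \<Rightarrow> (2 \<Rightarrow> real) \<Rightarrow> (2 \<Rightarrow> real) \<Rightarrow> state \<Rightarrow> state" where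
  "symmetrizer_map f g r \<kappa> x = state_vec
     ((1 + (\<Sum>k\<in>UNIV. (f k)\<^sup>2 / \<kappa> k + (g k)\<^sup>2 / r k)) * x $ 1
        + (\<Sum>k\<in>UNIV. f k * vel x k + g k * pres x k))
     (\<lambda>k. f k * x $ 1 + \<kappa> k * vel x k)
     (\<lambda>k. g k * x $ 1 + r k * pres x k)
     (entr x)"

lemma linear_transport_map: "linear (transport_map v b c u r \<kappa>)"
  by (rule linearI) (simp_all add: transport_map_def state_eq_iff algebra_simps)

lemma linear_symmetrizer_map: "linear (symmetrizer_map f g r \<kappa>)"
  by (rule linearI)
    (simp_all add: symmetrizer_map_def state_eq_iff sum_2 algebra_simps add_divide_distrib)

lemma symmetric_matrix_symmetrizer_map: "symmetric_matrix (matrix (symmetrizer_map f g r \<kappa>))"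
  by (rule symmetric_matrixI[OF linear_symmetrizer_map])
    (simp add: inner_state symmetrizer_map_def sum_2 algebra_simps)

text \<open>Completing the squares in velocity and pressure uses up the two sums in the corner entry
  and leaves \<open>(x $ 1)\<^sup>2\<close> plus nonnegative terms.\<close>

lemma positive_definite_symmetrizer_map:
  assumes "\<And>k. r k > 0" "\<And>k. \<kappa> k > 0"
  shows "positive_definite (matrix (symmetrizer_map f g r \<kappa>))"
  unfolding positive_definite_def
proof (intro allI impI)
  fix x :: state assume "x \<noteq> 0"
  let ?q = "\<lambda>k. \<kappa> k * (vel x k + f k * x $ 1 / \<kappa> k)\<^sup>2 + r k * (pres x k + g k * x $ 1 / r k)\<^sup>2
      + (entr x k)\<^sup>2"
  have sq: "\<kappa> * (y + a * z / \<kappa>)\<^sup>2 = \<kappa> * y\<^sup>2 + 2 * a * y * z + a\<^sup>2 / \<kappa> * z\<^sup>2" if "\<kappa> > 0"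
    for \<kappa> y a z :: real
    using that by (simp add: field_simps power2_eq_square)
  have eq: "x \<bullet> (matrix (symmetrizer_map f g r \<kappa>) *v x) = (x $ 1)\<^sup>2 + (\<Sum>k\<in>UNIV. ?q k)"
    by (simp add: fun_cong[OF matrix_vector_mul(2)[OF linear_symmetrizer_map]] sq assms)
      (simp add: inner_state symmetrizer_map_def sum_2 algebra_simps power2_eq_square)
  have q: "?q k \<ge> 0" for k
    using assms[of k] by (intro add_nonneg_nonneg mult_nonneg_nonneg) auto
  show "x \<bullet> (matrix (symmetrizer_map f g r \<kappa>) *v x) > 0"
  proof (cases "x $ 1 = 0")
    case False
    then show ?thesis
      unfolding eq by (intro add_pos_nonneg sum_nonneg q) auto
  next
    case True
    then obtain k where "vel x k \<noteq> 0 \<or> pres x k \<noteq> 0 \<or> entr x k \<noteq> 0"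
      using \<open>x \<noteq> 0\<close> by (auto simp: state_eq_iff)
    then have "?q k \<noteq> 0"
      using assms[of k] True
      by (auto simp: add_nonneg_eq_0_iff less_imp_le mult_eq_0_iff)
    then have "?q k > 0"
      using q[of k] by linarith
    then have "(\<Sum>k\<in>UNIV. ?q k) > 0"
      by (intro sum_pos2[of _ k] q) auto
    then show ?thesis
      unfolding eq using True by simp
  qed
qed

text \<open>The hypotheses are the two components of \<open>(A\<^sup>T - v) w = Q b\<close> with
  \<open>w = (f, g)\<close>. The product has coefficients \<open>f v + \<kappa> b\<close> and
  \<open>g v + r c\<close> in its first column, against \<open>f u + g \<kappa>\<close> and
  \<open>f r + g u\<close> in its first row; the hypotheses equate them.\<close>

lemma symmetric_matrix_symmetrized_transport:
  assumes f: "\<And>k. f k * (u k - v) + g k * \<kappa> k = \<kappa> k * b k"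
    and g: "\<And>k. f k * r k + g k * (u k - v) = r k * c k"
  shows "symmetric_matrix (matrix (symmetrizer_map f g r \<kappa>) ** matrix (transport_map v b c u r \<kappa>))"
proof -
  let ?S = "symmetrizer_map f g r \<kappa>" and ?T = "transport_map v b c u r \<kappa>"
  define \<theta> where "\<theta> = 1 + (\<Sum>k\<in>UNIV. (f k)\<^sup>2 / \<kappa> k + (g k)\<^sup>2 / r k)"
  \<comment> \<open>The contribution of phase \<open>k\<close> to the bilinear form, in a shape
    visibly symmetric in \<open>x\<close> and \<open>y\<close>.\<close>
  define B where "B x y k = u k * (\<kappa> k * vel x k * vel y k + r k * pres x k * pres y k + entr x k * entr y k)
      + r k * \<kappa> k * (vel x k * pres y k + pres x k * vel y k)
      + (f k * b k + g k * c k) * x $ 1 * y $ 1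
      + (f k * u k + g k * \<kappa> k) * (x $ 1 * vel y k + vel x k * y $ 1)
      + (f k * r k + g k * u k) * (x $ 1 * pres y k + pres x k * y $ 1)" for x y :: state and k
  have "y \<bullet> ?S (?T x) = \<theta> * v * x $ 1 * y $ 1 + (\<Sum>k\<in>UNIV. B x y k)" for x y
  proof -
    define F where "F k = f k * (b k * x $ 1 + u k * vel x k + r k * pres x k)
        + g k * (c k * x $ 1 + \<kappa> k * vel x k + u k * pres x k)" for k
    define H where "H k = vel y k * (f k * (v * x $ 1) + \<kappa> k * (b k * x $ 1 + u k * vel x k + r k * pres x k))
        + pres y k * (g k * (v * x $ 1) + r k * (c k * x $ 1 + \<kappa> k * vel x k + u k * pres x k))
        + entr y k * (u k * entr x k)" for k
    have "y \<bullet> ?S (?T x) = y $ 1 * (\<theta> * (v * x $ 1) + (\<Sum>k\<in>UNIV. F k)) + (\<Sum>k\<in>UNIV. H k)"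
      by (simp add: inner_state symmetrizer_map_def transport_map_def F_def H_def flip: \<theta>_def)
    also have "\<dots> = \<theta> * v * x $ 1 * y $ 1 + (\<Sum>k\<in>UNIV. y $ 1 * F k + H k)"
      by (simp add: distrib_left sum.distrib sum_distrib_left)
    finally have "y \<bullet> ?S (?T x) = \<theta> * v * x $ 1 * y $ 1 + (\<Sum>k\<in>UNIV. y $ 1 * F k + H k)" .
    moreover have "y $ 1 * F k + H k = B x y k" for k
      unfolding F_def H_def B_def using f[of k] g[of k] by algebra
    ultimately show ?thesis by simp
  qed
  moreover have "B x y k = B y x k" for x y k
    by (simp add: B_def algebra_simps)
  ultimately have "y \<bullet> (?S \<circ> ?T) x = x \<bullet> (?S \<circ> ?T) y" for x y
    by simp
  then have "symmetric_matrix (matrix (?S \<circ> ?T))"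
    by (intro symmetric_matrixI linear_compose linear_transport_map linear_symmetrizer_map) auto
  then show ?thesis
    by (simp add: matrix_compose linear_transport_map linear_symmetrizer_map)
qed

lemma smooth_on_matrix_symmetrizer_map:
  assumes S: "open S"
    and "\<And>k. smooth_on S (f k)" "\<And>k. smooth_on S (g k)"
    and "\<And>k. smooth_on S (r k)" "\<And>k. smooth_on S (\<kappa> k)"
    and "\<And>x k. x \<in> S \<Longrightarrow> r k x \<noteq> 0" "\<And>x k. x \<in> S \<Longrightarrow> \<kappa> k x \<noteq> 0"
  shows "smooth_on S (\<lambda>x. matrix
    (symmetrizer_map (\<lambda>k. f k x) (\<lambda>k. g k x) (\<lambda>k. r k x) (\<lambda>k. \<kappa> k x)))"
proof (intro smooth_on_vec_lambda S)
  fix i j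
  have "smooth_on S (\<lambda>x. symmetrizer_map (\<lambda>k. f k x) (\<lambda>k. g k x) (\<lambda>k. r k x) (\<lambda>k. \<kappa> k x) y $ i)"
    for y
    unfolding symmetrizer_map_def state_vec_def sum_2
    using exhaust_7[of i]
    by (elim disjE; simp; intro smooth_on_add smooth_on_mult smooth_on_divide smooth_on_power
        smooth_on_const assms)
  then show "smooth_on S (\<lambda>x. matrix
      (symmetrizer_map (\<lambda>k. f k x) (\<lambda>k. g k x) (\<lambda>k. r k x) (\<lambda>k. \<kappa> k x)) $ i $ j)"
    by (simp add: matrix_def)
qed

section \<open>The quasilinear form and its symmetrizer\<close>


lemma dtI: "(f has_derivative f') (at z) \<Longrightarrow> dt f z = f' (1, 0)"
  and dxI: "(f has_derivative f') (at z) \<Longrightarrow> dx f z = f' (0, 1)"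
  by (simp_all add: dt_def dx_def flip: frechet_derivative_at)

text \<open>The balance laws are triangular combinations of the equations for pressure, velocity and
  entropy; \<open>\<beta>\<close> is the derivative of the pressure in \<open>e\<close> and \<open>\<kappa>\<close> is \<open>\<rho> c\<^sup>2\<close>.\<close>

lemma balance_laws_iff:
  fixes \<alpha> \<tau> e u p E T \<kappa> \<beta> v q w :: real
    and \<alpha>\<^sub>t \<alpha>\<^sub>x \<tau>\<^sub>t \<tau>\<^sub>x e\<^sub>t e\<^sub>x u\<^sub>t u\<^sub>x p\<^sub>t p\<^sub>x s\<^sub>t s\<^sub>x :: real
  assumes pos: "\<alpha> > 0" "\<tau> > 0" "T > 0" "\<kappa> > 0"
    and \<alpha>: "\<alpha>\<^sub>t + v * \<alpha>\<^sub>x = 0"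
    and \<tau>: "\<tau>\<^sub>t = \<tau> / \<kappa> * (\<beta> * T * s\<^sub>t - p\<^sub>t)" "\<tau>\<^sub>x = \<tau> / \<kappa> * (\<beta> * T * s\<^sub>x - p\<^sub>x)"
    and e: "e\<^sub>t = T * s\<^sub>t - p * \<tau>\<^sub>t" "e\<^sub>x = T * s\<^sub>x - p * \<tau>\<^sub>x"
    and work: "u * q - w = p * (u - v)"
    and E: "E = e + u\<^sup>2 / 2"
  defines "\<rho>\<^sub>t \<equiv> - \<tau>\<^sub>t / \<tau>\<^sup>2" and "\<rho>\<^sub>x \<equiv> - \<tau>\<^sub>x / \<tau>\<^sup>2"
    and "E\<^sub>t \<equiv> e\<^sub>t + u * u\<^sub>t" and "E\<^sub>x \<equiv> e\<^sub>x + u * u\<^sub>x"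
    and "m \<equiv> \<alpha> / \<tau>"
  defines "m\<^sub>t \<equiv> \<alpha>\<^sub>t / \<tau> + \<alpha> * \<rho>\<^sub>t" and "m\<^sub>x \<equiv> \<alpha>\<^sub>x / \<tau> + \<alpha> * \<rho>\<^sub>x"
  shows "(m\<^sub>t + (m\<^sub>x * u + m * u\<^sub>x) = 0 \<and>
      (m\<^sub>t * u + m * u\<^sub>t) + (m\<^sub>x * u\<^sup>2 + m * (2 * u * u\<^sub>x) + (\<alpha>\<^sub>x * p + \<alpha> * p\<^sub>x)) - q * \<alpha>\<^sub>x = 0 \<and>
      (m\<^sub>t * E + m * E\<^sub>t) + (m\<^sub>x * (E + p * \<tau>) * u + m * (E\<^sub>x + (p\<^sub>x * \<tau> + p * \<tau>\<^sub>x)) * u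
        + m * (E + p * \<tau>) * u\<^sub>x) - w * \<alpha>\<^sub>x = 0)
    \<longleftrightarrow> (u\<^sub>t + (\<tau> * (p - q) / \<alpha> * \<alpha>\<^sub>x + u * u\<^sub>x + \<tau> * p\<^sub>x) = 0 \<and>
         p\<^sub>t + (\<kappa> * (u - v) / \<alpha> * \<alpha>\<^sub>x + \<kappa> * u\<^sub>x + u * p\<^sub>x) = 0 \<and>
         s\<^sub>t + u * s\<^sub>x = 0)"
    (is "?mass = 0 \<and> ?mom = 0 \<and> ?en = 0 \<longleftrightarrow> ?U = 0 \<and> ?P = 0 \<and> ?S = 0")
proof -
  have \<alpha>t: "\<alpha>\<^sub>t = - v * \<alpha>\<^sub>x"
    using \<alpha> by simp
  have \<rho>\<tau>: "\<tau>\<^sub>t = - \<tau>\<^sup>2 * \<rho>\<^sub>t" "\<tau>\<^sub>x = - \<tau>\<^sup>2 * \<rho>\<^sub>x"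
    using pos by (simp_all add: \<rho>\<^sub>t_def \<rho>\<^sub>x_def)
  have \<rho>: "\<rho>\<^sub>t = (p\<^sub>t - \<beta> * T * s\<^sub>t) / (\<tau> * \<kappa>)" "\<rho>\<^sub>x = (p\<^sub>x - \<beta> * T * s\<^sub>x) / (\<tau> * \<kappa>)"
    using pos by (simp_all add: \<rho>\<^sub>t_def \<rho>\<^sub>x_def \<tau> field_simps power2_eq_square)
  \<comment> \<open>With \<open>\<alpha>\<^sub>t\<close> eliminated by transport and the density
    derivatives expressed through \<open>p\<close> and \<open>s\<close>, mass conservation is a
    pressure equation up to a multiple of entropy transport.\<close>
  have mass: "?mass = m / \<kappa> * ?P - m / \<kappa> * \<beta> * T * ?S"
    using pos unfolding m\<^sub>t_def m\<^sub>x_def m_def \<rho> \<alpha>t by (simp add: field_simps)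
  have mom: "?mom = u * ?mass + m * ?U"
    using pos unfolding m_def by (simp add: field_simps power2_eq_square)
  \<comment> \<open>Removing multiples of the mass and momentum balances from the energy balance
    leaves \<open>m T\<close> times entropy transport. The remaining terms cancel by
    \<open>work\<close>, by \<open>m \<tau> = \<alpha>\<close> and by the time derivative of the
    latter.\<close>
  have en: "?en = (E + p * \<tau> - u\<^sup>2) * ?mass + u * ?mom + m * T * ?S"
  proof -
    have w: "w = u * q - p * (u - v)"
      using work by simp
    have m\<tau>: "m * \<tau> = \<alpha>" "m\<^sub>t * \<tau> + m * \<tau>\<^sub>t = \<alpha>\<^sub>t"
      using pos unfolding m\<^sub>t_def m_def \<rho>\<tau> by (simp_all add: field_simps power2_eq_square)
    have "?en - ((E + p * \<tau> - u\<^sup>2) * ?mass + u * ?mom + m * T * ?S)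
      = u * p\<^sub>x * (m * \<tau> - \<alpha>) - p * (m\<^sub>t * \<tau> + m * \<tau>\<^sub>t + v * \<alpha>\<^sub>x)"
      unfolding E\<^sub>t_def E\<^sub>x_def e w by (simp add: algebra_simps power2_eq_square)
    then show ?thesis
      using m\<tau> \<alpha> by simp
  qed
  have "m > 0"
    using pos by (simp add: m_def)
  show ?thesis
  proof
    assume *: "?mass = 0 \<and> ?mom = 0 \<and> ?en = 0"
    \<comment> \<open>Back substitution: momentum gives \<open>?U\<close>, energy gives
      \<open>?S\<close>, and only then does mass give \<open>?P\<close>; the factors
      \<open>m\<close>, \<open>m T\<close> and \<open>m/\<kappa>\<close> are positive.\<close>
    then have "?U = 0" "?S = 0"
      using mom en \<open>m > 0\<close> pos by auto
    moreover from this have "?P = 0"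
      using mass * \<open>m > 0\<close> pos by auto
    ultimately show "?U = 0 \<and> ?P = 0 \<and> ?S = 0" by blast
  next
    assume *: "?U = 0 \<and> ?P = 0 \<and> ?S = 0"
    then have 1: "?mass = 0" unfolding mass by simp
    with * have 2: "?mom = 0" unfolding mom by simp
    with 1 * have "?en = 0" unfolding en by simp
    with 1 2 show "?mass = 0 \<and> ?mom = 0 \<and> ?en = 0" by blast
  qed
qed


text \<open>The factor in \<open>\<partial>\<alpha>\<^sub>k = \<plusminus>
  \<partial>\<alpha>\<^sub>1\<close>. It converts equations written with the own volume fraction of
  each phase into the state variable \<open>\<alpha>\<^sub>1\<close>.\<close>

definition phase_sign :: "2 \<Rightarrow> real" where
  "phase_sign k = (if k = 1 then 1 else - 1)"

definition bulk_modulus :: "(2 \<Rightarrow> eos) \<Rightarrow> state \<Rightarrow> 2 \<Rightarrow> real" where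
  "bulk_modulus A U k = sound_sq (A k) (thermo A U k) / fst (thermo A U k)"

text \<open>Together with \<open>pressure_coupling\<close>, the column \<open>b\<close> of the
  volume fraction: momentum leaves the excess \<open>p\<^sub>k - p\<^sub>I\<close>, and mass the
  slip \<open>u\<^sub>k - u\<close>, as factor of
  \<open>\<partial>\<^sub>x \<alpha>\<^sub>k\<close>.\<close>

definition velocity_coupling :: "(2 \<Rightarrow> eos) \<Rightarrow> state \<Rightarrow> 2 \<Rightarrow> real" where
  "velocity_coupling A U k =
     phase_sign k * (fst (thermo A U k) * (pres U k - interf_pres A U) / alpha U k)"

definition pressure_coupling :: "(2 \<Rightarrow> eos) \<Rightarrow> state \<Rightarrow> 2 \<Rightarrow> real" where
  "pressure_coupling A U k =
     phase_sign k * (bulk_modulus A U k * (vel U k - mix_vel A U) / alpha U k)"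

definition system_map :: "(2 \<Rightarrow> eos) \<Rightarrow> state \<Rightarrow> state \<Rightarrow> state" where
  "system_map A U = transport_map (mix_vel A U) (velocity_coupling A U) (pressure_coupling A U)
     (vel U) (\<lambda>k. fst (thermo A U k)) (bulk_modulus A U)"

section \<open>Regularity on the admissible states and reduction of the balance laws\<close>

context
  fixes A :: "2 \<Rightarrow> eos"
  assumes A: "\<forall>k. complete_eos (A k)"
begin

lemma complete_eosI: "complete_eos (A k)"
  using A by blast

lemma ps_image: "U \<in> states A \<Longrightarrow> (pres U k, entr U k) \<in> ps_map (A k) ` eos_dom (A k)"
  by (simp add: states_def)

lemma
  assumes "U \<in> states A"
  shows thermo_in_eos_dom: "thermo A U k \<in> eos_dom (A k)"
    and ps_map_thermo: "ps_map (A k) (thermo A U k) = (pres U k, entr U k)"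
  using inv_into_into[OF ps_image[OF assms]] f_inv_into_f[OF ps_image[OF assms]]
  by (simp_all add: thermo_def)

lemma
  assumes "U \<in> states A"
  shows alpha_pos: "alpha U k > 0"
    and spec_vol_pos: "fst (thermo A U k) > 0"
    and bulk_modulus_pos: "bulk_modulus A U k > 0"
    and mix_dens_pos: "mix_dens A U > 0"
    and sound_sq_eq: "(sound A U k)\<^sup>2 = bulk_modulus A U k * fst (thermo A U k)"
proof -
  show \<alpha>: "alpha U k > 0" for k
    using assms by (auto simp: states_def alpha_def)
  show \<tau>: "fst (thermo A U k) > 0" for k
    using fst_eos_dom_pos[OF complete_eosI thermo_in_eos_dom[OF assms]] .
  show "bulk_modulus A U k > 0"
    using \<tau> sound_sq_pos[OF complete_eosI thermo_in_eos_dom[OF assms]]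
    by (simp add: bulk_modulus_def)
  show "mix_dens A U > 0"
    unfolding mix_dens_def dens_def using \<alpha> \<tau> by (intro add_pos_pos mult_pos_pos) auto
  show "(sound A U k)\<^sup>2 = bulk_modulus A U k * fst (thermo A U k)"
    using \<tau>[of k] sound_speed_sq[OF complete_eosI thermo_in_eos_dom[OF assms]]
    by (simp add: sound_def bulk_modulus_def)
qed

text \<open>Rests on \<open>Y\<^sub>1 + Y\<^sub>2 = 1\<close>. This compatibility of the interfacial
  pressure and work is what keeps the gradient of the volume fraction out of the entropy
  equations.\<close>

lemma interface_work_identity:
  assumes "U \<in> states A"
  shows "vel U k * interf_pres A U - interf_work A U = pres U k * (vel U k - mix_vel A U)"
proof -
  have "mass_frac A U 1 + mass_frac A U 2 = 1"
    using mix_dens_pos[OF assms]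
    by (simp add: mass_frac_def mix_dens_def flip: add_divide_distrib)
  then have 1: "mass_frac A U 1 = 1 - mass_frac A U 2"
    by simp
  show ?thesis
    using exhaust_2[of k]
    by (elim disjE) (simp_all add: interf_pres_def interf_work_def mix_vel_def 1 algebra_simps)
qed

lemma open_states: "open (states A)"
proof -
  let ?f = "\<lambda>k U. (pres U k, entr U k)"
  have "open ({U::state. 0 < U $ 1} \<inter> {U. U $ 1 < 1} \<inter>
      (\<Inter>k. ?f k -` (ps_map (A k) ` eos_dom (A k))))"
  proof (intro open_Int open_Collect_less open_INT ballI open_vimage)
    show "open (ps_map (A k) ` eos_dom (A k))" for k
      by (rule open_ps_map_image[OF complete_eosI])
    show "continuous_on UNIV (?f k)" for k
      by (intro continuous_on_Pair linear_continuous_on bounded_linear_components)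
  qed (simp_all add: continuous_on_const continuous_on_component)
  also have "\<dots> = states A"
    by (auto simp: states_def)
  finally show ?thesis .
qed

lemma smooth_on_components:
  assumes "open S"
  shows "smooth_on S (\<lambda>U. vel U k)" "smooth_on S (\<lambda>U. pres U k)" "smooth_on S (\<lambda>U. entr U k)"
    "smooth_on S (\<lambda>U. alpha U k)"
proof -
  show "smooth_on S (\<lambda>U. vel U k)" "smooth_on S (\<lambda>U. pres U k)" "smooth_on S (\<lambda>U. entr U k)"
    by (intro smooth_on_linear[OF assms] bounded_linear_components)+
  have *: "smooth_on S (\<lambda>U::state. U $ 1)"
    by (intro smooth_on_linear[OF assms] bounded_linear_vec_nth)
  then have "smooth_on S (\<lambda>U::state. 1 - U $ 1)"
    by (intro smooth_on_diff[OF assms] smooth_on_const[OF assms])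
  with * show "smooth_on S (\<lambda>U. alpha U k)"
    by (cases "k = 1") (simp_all add: alpha_def)
qed

text \<open>The state enters the equations of state through \<open>thermo\<close>, so smoothness of
  the densities, mass fractions and bulk moduli all rests on the smooth inverse of
  \<open>ps_map\<close>.\<close>

lemma smooth_on_thermo: "smooth_on (states A) (\<lambda>U. thermo A U k)"
  unfolding thermo_def
  by (rule smooth_on_compose[OF smooth_on_ps_map_inv[OF complete_eosI] _ open_states
        open_ps_map_image[OF complete_eosI]])
    (auto intro!: smooth_on_Pair smooth_on_components open_states simp: ps_image)

lemma smooth_on_spec_vol: "smooth_on (states A) (\<lambda>U. fst (thermo A U k))"
  by (rule smooth_on_linear_compose[OF open_states bounded_linear_fst smooth_on_thermo])

lemma smooth_on_bulk_modulus: "smooth_on (states A) (\<lambda>U. bulk_modulus A U k)"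
proof -
  have "smooth_on (states A) (\<lambda>U. sound_sq (A k) (thermo A U k))"
    using thermo_in_eos_dom
    by (intro smooth_on_compose[OF smooth_on_sound_sq[OF complete_eosI] smooth_on_thermo open_states
        open_eos_dom[OF complete_eosI]]) auto
  then show ?thesis
    unfolding bulk_modulus_def using spec_vol_pos
    by (intro smooth_on_divide open_states smooth_on_spec_vol) (auto simp: less_imp_neq[THEN not_sym])
qed

lemma smooth_on_mass_frac: "smooth_on (states A) (\<lambda>U. mass_frac A U k)"
proof -
  have dens: "smooth_on (states A) (\<lambda>U. dens A U k)" for k
    unfolding dens_def using spec_vol_pos
    by (intro smooth_on_divide open_states smooth_on_spec_vol smooth_on_const)
      (auto simp: less_imp_neq[THEN not_sym])
  have "mix_dens A U \<noteq> 0" if "U \<in> states A" for U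
    using mix_dens_pos[OF that] by simp
  moreover have "smooth_on (states A) (mix_dens A)"
    unfolding mix_dens_def[abs_def]
    by (intro smooth_on_add smooth_on_mult open_states smooth_on_components dens)
  ultimately show ?thesis
    unfolding mass_frac_def
    by (intro smooth_on_divide smooth_on_mult open_states smooth_on_components dens)
qed

lemma smooth_on_mix_vel: "smooth_on (states A) (mix_vel A)"
  unfolding mix_vel_def[abs_def]
  by (intro smooth_on_add smooth_on_mult open_states smooth_on_components smooth_on_mass_frac)

lemma smooth_on_couplings:
  "smooth_on (states A) (\<lambda>U. velocity_coupling A U k)"
  "smooth_on (states A) (\<lambda>U. pressure_coupling A U k)"
proof -
  have \<alpha>: "alpha U k \<noteq> 0" if "U \<in> states A" for U
    using alpha_pos[OF that, of k] by simp
  show "smooth_on (states A) (\<lambda>U. velocity_coupling A U k)"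
    unfolding velocity_coupling_def interf_pres_def
    by (intro smooth_on_mult smooth_on_divide smooth_on_diff smooth_on_add smooth_on_const
        open_states smooth_on_components smooth_on_spec_vol smooth_on_mass_frac \<alpha>)
  show "smooth_on (states A) (\<lambda>U. pressure_coupling A U k)"
    unfolding pressure_coupling_def
    by (intro smooth_on_mult smooth_on_divide smooth_on_diff smooth_on_const
        open_states smooth_on_components smooth_on_bulk_modulus smooth_on_mix_vel \<alpha>)
qed

text \<open>Since \<open>\<partial>\<^sub>x \<alpha>\<^sub>2 = - \<partial>\<^sub>x
  \<alpha>\<^sub>1\<close>, the opposite signs of the interface terms vanish when each phase uses
  its own fraction: both phases then obey the same three laws.\<close>

lemma phase_balance_iff:
  assumes \<Omega>: "open \<Omega>" "smooth_on \<Omega> U" "U ` \<Omega> \<subseteq> states A" "z \<in> \<Omega>"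
    and \<alpha>: "dt U z $ 1 + mix_vel A (U z) * dx U z $ 1 = 0"
  defines "W \<equiv> dt U z + system_map A (U z) (dx U z)"
  shows "(dt (\<lambda>y. alpha (U y) k * dens A (U y) k) z
        + dx (\<lambda>y. alpha (U y) k * dens A (U y) k * vel (U y) k) z = 0 \<and>
      dt (\<lambda>y. alpha (U y) k * dens A (U y) k * vel (U y) k) z
        + dx (\<lambda>y. alpha (U y) k * dens A (U y) k * (vel (U y) k)\<^sup>2 + alpha (U y) k * pres (U y) k) z
        - interf_pres A (U z) * dx (\<lambda>y. alpha (U y) k) z = 0 \<and>
      dt (\<lambda>y. alpha (U y) k * dens A (U y) k * tot_energy A (U y) k) z
        + dx (\<lambda>y. alpha (U y) k * dens A (U y) k * tot_enthalpy A (U y) k * vel (U y) k) z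
        - interf_work A (U z) * dx (\<lambda>y. alpha (U y) k) z = 0)
    \<longleftrightarrow> (vel W k = 0 \<and> pres W k = 0 \<and> entr W k = 0)"
proof -
  have Uz: "U z \<in> states A"
    using \<Omega> by blast
  define D where "D = frechet_derivative U (at z)"
  have D: "(U has_derivative D) (at z)"
    unfolding D_def using smooth_on_has_derivative[OF \<Omega>(2,4)] .
  define X where "X = thermo A (U z) k"
  define T where "T = temperature (A k) X"
  define \<beta> where "\<beta> = frechet_derivative (pressure (A k)) (at X) (0, 1)"
  define \<kappa> where "\<kappa> = bulk_modulus A (U z) k"
  note X = thermo_in_eos_dom[OF Uz, of k, folded X_def]
  note pos = alpha_pos[OF Uz, of k] spec_vol_pos[OF Uz, of k, folded X_def]
    temperature_pos[OF complete_eosI X, folded T_def] bulk_modulus_pos[OF Uz, of k, folded \<kappa>_def]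

  \<comment> \<open>The primed quantities are differentials in a space-time direction
    \<open>h\<close>; taking \<open>h\<close> to be \<open>(1, 0)\<close> or \<open>(0, 1)\<close>
    yields the time and space derivatives from one computation.\<close>
  define \<tau>' where "\<tau>' h = fst X / \<kappa> * (\<beta> * T * entr (D h) k - pres (D h) k)" for h
  define e' where "e' h = T * entr (D h) k - pres (U z) k * \<tau>' h" for h
  define \<alpha>' where "\<alpha>' h = phase_sign k * D h $ 1" for h
  define m' where "m' h = \<alpha>' h / fst X + alpha (U z) k * (- \<tau>' h / (fst X)\<^sup>2)" for h
  define m where "m = alpha (U z) k / fst X"
  define E' where "E' h = e' h + vel (U z) k * vel (D h) k" for h
  define E where "E = tot_energy A (U z) k"

  have du: "((\<lambda>y. vel (U y) k) has_derivative (\<lambda>h. vel (D h) k)) (at z)"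
    and dp: "((\<lambda>y. pres (U y) k) has_derivative (\<lambda>h. pres (D h) k)) (at z)"
    and ds: "((\<lambda>y. entr (U y) k) has_derivative (\<lambda>h. entr (D h) k)) (at z)"
    by (intro bounded_linear.has_derivative[OF _ D] bounded_linear_components)+
  have d1: "((\<lambda>y. U y $ 1) has_derivative (\<lambda>h. D h $ 1)) (at z)"
    by (intro bounded_linear.has_derivative[OF _ D] bounded_linear_vec_nth)
  have d\<alpha>: "((\<lambda>y. alpha (U y) k) has_derivative \<alpha>') (at z)"
    using d1 has_derivative_diff[OF has_derivative_const[of 1] d1]
    by (simp add: alpha_def \<alpha>'_def[abs_def] phase_sign_def)
  have "pressure (A k) X = pres (U z) k"
    using ps_map_thermo[OF Uz, of k] by (simp add: ps_map_def X_def)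
  moreover have "(fst X)\<^sup>2 / sound_sq (A k) X = fst X / \<kappa>"
    using pos by (simp add: \<kappa>_def bulk_modulus_def X_def power2_eq_square)
  ultimately have inv: "ps_inv_deriv (A k) X (pres (D h) k, entr (D h) k) = (\<tau>' h, e' h)" for h
    by (simp add: ps_inv_deriv_def Let_def \<tau>'_def e'_def T_def \<beta>_def)
  have "(inv_into (eos_dom (A k)) (ps_map (A k)) has_derivative ps_inv_deriv (A k) X)
      (at (pres (U z) k, entr (U z) k))"
    using ps_map_inv_has_derivative[OF complete_eosI X] ps_map_thermo[OF Uz, of k]
    by (simp add: X_def)
  from has_derivative_compose[OF has_derivative_Pair[OF dp ds] this]
  have dX: "((\<lambda>y. thermo A (U y) k) has_derivative (\<lambda>h. (\<tau>' h, e' h))) (at z)"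
    by (simp add: thermo_def inv)
  have d\<tau>: "((\<lambda>y. fst (thermo A (U y) k)) has_derivative \<tau>') (at z)"
    using has_derivative_fst[OF dX] by simp
  have dm: "((\<lambda>y. alpha (U y) k * dens A (U y) k) has_derivative m') (at z)"
    unfolding dens_def m'_def[abs_def] using pos
    by (auto intro!: derivative_eq_intros d\<alpha> dX simp: X_def field_simps power2_eq_square)
  have dE: "((\<lambda>y. tot_energy A (U y) k) has_derivative E') (at z)"
    unfolding tot_energy_def int_energy_def E'_def[abs_def]
    by (auto intro!: derivative_eq_intros dX du)
  have dmu: "((\<lambda>y. alpha (U y) k * dens A (U y) k * vel (U y) k) has_derivative
      (\<lambda>h. m' h * vel (U z) k + m * vel (D h) k)) (at z)"
    by (rule has_derivative_eq_rhs[OF has_derivative_mult[OF dm du]])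
      (simp add: fun_eq_iff dens_def m_def X_def)
  have dmE: "((\<lambda>y. alpha (U y) k * dens A (U y) k * tot_energy A (U y) k) has_derivative
      (\<lambda>h. m' h * E + m * E' h)) (at z)"
    by (rule has_derivative_eq_rhs[OF has_derivative_mult[OF dm dE]])
      (simp add: fun_eq_iff dens_def m_def X_def E_def)
  have dmuu: "((\<lambda>y. alpha (U y) k * dens A (U y) k * (vel (U y) k)\<^sup>2 + alpha (U y) k * pres (U y) k)
      has_derivative (\<lambda>h. m' h * (vel (U z) k)\<^sup>2 + m * (2 * vel (U z) k * vel (D h) k)
        + (\<alpha>' h * pres (U z) k + alpha (U z) k * pres (D h) k))) (at z)"
    by (rule has_derivative_eq_rhs[OF has_derivative_add[OF
            has_derivative_mult[OF dm has_derivative_power[OF du]] has_derivative_mult[OF d\<alpha> dp]]])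
      (simp add: fun_eq_iff dens_def m_def X_def)
  have H: "tot_enthalpy A V k = tot_energy A V k + pres V k * fst (thermo A V k)" for V
    by (simp add: tot_enthalpy_def dens_def)
  have dmHu: "((\<lambda>y. alpha (U y) k * dens A (U y) k * tot_enthalpy A (U y) k * vel (U y) k)
      has_derivative (\<lambda>h. m' h * (E + pres (U z) k * fst X) * vel (U z) k
        + m * (E' h + (pres (D h) k * fst X + pres (U z) k * \<tau>' h)) * vel (U z) k
        + m * (E + pres (U z) k * fst X) * vel (D h) k)) (at z)"
    unfolding H
    by (rule has_derivative_eq_rhs[OF has_derivative_mult[OF has_derivative_mult[OF dm
            has_derivative_add[OF dE has_derivative_mult[OF dp d\<tau>]]] du]])
      (simp add: fun_eq_iff dens_def m_def X_def E_def algebra_simps)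

  have Dt: "dt U z = D (1, 0)" and Dx: "dx U z = D (0, 1)"
    using dtI[OF D] dxI[OF D] .
  have "\<alpha>' (1, 0) + mix_vel A (U z) * \<alpha>' (0, 1) = 0"
    using \<alpha> unfolding Dt Dx by (auto simp: \<alpha>'_def phase_sign_def)
  moreover have "E = snd X + (vel (U z) k)\<^sup>2 / 2"
    by (simp add: E_def tot_energy_def int_energy_def X_def)
  ultimately have balance: "(m' (1, 0) + (m' (0, 1) * vel (U z) k + m * vel (D (0, 1)) k) = 0 \<and>
      (m' (1, 0) * vel (U z) k + m * vel (D (1, 0)) k)
        + (m' (0, 1) * (vel (U z) k)\<^sup>2 + m * (2 * vel (U z) k * vel (D (0, 1)) k)
          + (\<alpha>' (0, 1) * pres (U z) k + alpha (U z) k * pres (D (0, 1)) k))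
        - interf_pres A (U z) * \<alpha>' (0, 1) = 0 \<and>
      (m' (1, 0) * E + m * E' (1, 0)) + (m' (0, 1) * (E + pres (U z) k * fst X) * vel (U z) k
        + m * (E' (0, 1) + (pres (D (0, 1)) k * fst X + pres (U z) k * \<tau>' (0, 1))) * vel (U z) k
        + m * (E + pres (U z) k * fst X) * vel (D (0, 1)) k)
        - interf_work A (U z) * \<alpha>' (0, 1) = 0)
    \<longleftrightarrow> (vel (D (1, 0)) k + (fst X * (pres (U z) k - interf_pres A (U z)) / alpha (U z) k * \<alpha>' (0, 1)
          + vel (U z) k * vel (D (0, 1)) k + fst X * pres (D (0, 1)) k) = 0 \<and>
        pres (D (1, 0)) k + (\<kappa> * (vel (U z) k - mix_vel A (U z)) / alpha (U z) k * \<alpha>' (0, 1)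
          + \<kappa> * vel (D (0, 1)) k + vel (U z) k * pres (D (0, 1)) k) = 0 \<and>
        entr (D (1, 0)) k + vel (U z) k * entr (D (0, 1)) k = 0)"
    unfolding m'_def m_def E'_def
    using balance_laws_iff[OF pos _ \<tau>'_def[of "(1, 0)"] \<tau>'_def[of "(0, 1)"]
        e'_def[of "(1, 0)"] e'_def[of "(0, 1)"] interface_work_identity[OF Uz]]
    by blast
  have W: "vel W k = vel (D (1, 0)) k
      + (fst X * (pres (U z) k - interf_pres A (U z)) / alpha (U z) k * \<alpha>' (0, 1)
        + vel (U z) k * vel (D (0, 1)) k + fst X * pres (D (0, 1)) k)"
    "pres W k = pres (D (1, 0)) k
      + (\<kappa> * (vel (U z) k - mix_vel A (U z)) / alpha (U z) k * \<alpha>' (0, 1)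
        + \<kappa> * vel (D (0, 1)) k + vel (U z) k * pres (D (0, 1)) k)"
    "entr W k = entr (D (1, 0)) k + vel (U z) k * entr (D (0, 1)) k"
    by (simp_all add: W_def Dt Dx system_map_def transport_map_def velocity_coupling_def
        pressure_coupling_def \<alpha>'_def X_def \<kappa>_def mult_ac)
  show ?thesis
    unfolding dtI[OF dm] dtI[OF dmu] dtI[OF dmE] dxI[OF dmu] dxI[OF dmuu] dxI[OF dmHu] dxI[OF d\<alpha>] W
    using balance .
qed

lemma two_fluid_system_iff:
  assumes \<Omega>: "open \<Omega>" "smooth_on \<Omega> U" "U ` \<Omega> \<subseteq> states A" "z \<in> \<Omega>"
  shows "two_fluid_system_at A U z \<longleftrightarrow> dt U z + system_map A (U z) (dx U z) = 0"
proof -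
  let ?W = "dt U z + system_map A (U z) (dx U z)"
  have D: "(U has_derivative frechet_derivative U (at z)) (at z)"
    using smooth_on_has_derivative[OF \<Omega>(2,4)] .
  have d1: "((\<lambda>y. U y $ 1) has_derivative (\<lambda>h. frechet_derivative U (at z) h $ 1)) (at z)"
    by (intro bounded_linear.has_derivative[OF _ D] bounded_linear_vec_nth)
  have d2: "((\<lambda>y. 1 - U y $ 1) has_derivative (\<lambda>h. - frechet_derivative U (at z) h $ 1)) (at z)"
    using has_derivative_diff[OF has_derivative_const[of 1] d1] by simp
  have \<alpha>: "dt (\<lambda>y. alpha (U y) 1) z = dt U z $ 1" "dx (\<lambda>y. alpha (U y) 1) z = dx U z $ 1"
    "dx (\<lambda>y. alpha (U y) 2) z = - dx U z $ 1"
    using dtI[OF d1] dxI[OF d1] dxI[OF d2] by (simp_all add: alpha_def dt_def dx_def)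
  have W1: "?W $ 1 = dt U z $ 1 + mix_vel A (U z) * dx U z $ 1"
    by (simp add: system_map_def transport_map_def)
  show ?thesis
  \<comment> \<open>The phase equivalences presuppose transport of \<open>\<alpha>\<^sub>1\<close>.
    Where it fails, both sides are false.\<close>
  proof (cases "?W $ 1 = 0")
    case True
    note * = phase_balance_iff[OF \<Omega> True[unfolded W1]]
    show ?thesis
      unfolding state_eq_iff[of ?W 0] two_fluid_system_at_def Let_def forall_2
      using *[of 1] *[of 2] True W1 by (simp add: \<alpha>) blast
  next
    case False
    then show ?thesis
      using W1 by (auto simp: state_eq_iff two_fluid_system_at_def Let_def \<alpha>)
  qed
qed

lemma quasilinear_form_system_map: "quasilinear_form A (\<lambda>U. matrix (system_map A U))"
proof -
  have "matrix (system_map A U) *v x = system_map A U x" for U x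
    unfolding system_map_def using fun_cong[OF matrix_vector_mul(2)[OF linear_transport_map]] .
  then show ?thesis
    unfolding quasilinear_form_def using two_fluid_system_iff by auto
qed

text \<open>The four inequalities combine in pairs to
  \<open>(u\<^sub>k - u)\<^sup>2 \<noteq> c\<^sub>k\<^sup>2\<close>. The difference is free of the
  square root, hence smooth, and is the determinant of the linear system for \<open>(f, g)\<close>
  in phase \<open>k\<close>.\<close>

lemma non_resonant_iff:
  assumes "U \<in> states A"
  shows "non_resonant A U \<longleftrightarrow>
    (\<forall>k. (vel U k - mix_vel A U)\<^sup>2 - bulk_modulus A U k * fst (thermo A U k) \<noteq> 0)"
proof -
  have "mix_vel A U \<noteq> vel U k + sound A U k \<and> mix_vel A U \<noteq> vel U k - sound A U k \<longleftrightarrow>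
      (vel U k - mix_vel A U)\<^sup>2 - (sound A U k)\<^sup>2 \<noteq> 0" for k
    by (auto simp: power2_eq_iff)
  then show ?thesis
    by (simp add: non_resonant_def sound_sq_eq[OF assms])
qed

lemma smooth_on_characteristic:
  "smooth_on (states A) (\<lambda>U. (vel U k - mix_vel A U)\<^sup>2 - bulk_modulus A U k * fst (thermo A U k))"
  by (intro smooth_on_diff smooth_on_power smooth_on_mult open_states smooth_on_components
      smooth_on_mix_vel smooth_on_bulk_modulus smooth_on_spec_vol)

text \<open>Needed because \<open>smooth_on\<close> has its intended meaning only on open
  sets.\<close>

lemma open_non_resonant: "open {U \<in> states A. non_resonant A U}"
proof -
  let ?d = "\<lambda>k U. (vel U k - mix_vel A U)\<^sup>2 - bulk_modulus A U k * fst (thermo A U k)"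
  have "open (states A \<inter> ?d k -` (- {0}))" for k
    using smooth_on_imp_continuous_on[OF smooth_on_characteristic] open_states
    by (intro continuous_open_preimage) auto
  then have "open (\<Inter>k. states A \<inter> ?d k -` (- {0}))"
    by (intro open_INT) auto
  also have "(\<Inter>k. states A \<inter> ?d k -` (- {0})) = {U \<in> states A. non_resonant A U}"
    using non_resonant_iff by auto
  finally show ?thesis .
qed

lemma symmetrizable_system_map:
  "symmetrizable_on {U \<in> states A. non_resonant A U} (\<lambda>U. matrix (system_map A U))"
proof -
  let ?N = "{U \<in> states A. non_resonant A U}"
  let ?r = "\<lambda>U k. fst (thermo A U k)" and ?\<kappa> = "bulk_modulus A"
  let ?b = "velocity_coupling A" and ?c = "pressure_coupling A"
  let ?\<delta> = "\<lambda>U k. vel U k - mix_vel A U"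
  let ?d = "\<lambda>U k. (?\<delta> U k)\<^sup>2 - ?\<kappa> U k * ?r U k"
  txt \<open>\<open>(f, g)\<close> solves \<open>(A\<^sup>T - v) w = Q b\<close> for the acoustic block \<open>A\<close> of phase \<open>k\<close> and
    \<open>Q = diag (\<kappa>, r)\<close>; the determinant \<open>d\<close> vanishes exactly at resonance.\<close>
  let ?f = "\<lambda>U k. ?\<kappa> U k * (?\<delta> U k * ?b U k - ?r U k * ?c U k) / ?d U k"
  let ?g = "\<lambda>U k. ?r U k * (?\<delta> U k * ?c U k - ?\<kappa> U k * ?b U k) / ?d U k"
  let ?P = "\<lambda>U. matrix (symmetrizer_map (?f U) (?g U) (?r U) (?\<kappa> U))"
  have sub: "?N \<subseteq> states A"
    by blast
  have d: "?d U k \<noteq> 0" if "U \<in> ?N" for U k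
    using that non_resonant_iff by auto
  have pos: "?r U k \<noteq> 0" "?\<kappa> U k \<noteq> 0" if "U \<in> ?N" for U k
    using that spec_vol_pos[of U k] bulk_modulus_pos[of U k] by auto
  note smooth = open_non_resonant smooth_on_components[OF open_non_resonant]
    smooth_on_subset[OF smooth_on_spec_vol sub] smooth_on_subset[OF smooth_on_bulk_modulus sub]
    smooth_on_subset[OF smooth_on_couplings(1) sub] smooth_on_subset[OF smooth_on_couplings(2) sub]
    smooth_on_subset[OF smooth_on_mix_vel sub] smooth_on_subset[OF smooth_on_characteristic sub]
  have "smooth_on ?N (\<lambda>U. ?f U k)" "smooth_on ?N (\<lambda>U. ?g U k)" for k
    by (intro smooth_on_divide[OF _ _ _ d] smooth_on_mult smooth_on_diff smooth; assumption)+
  then have "smooth_on ?N ?P"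
    by (intro smooth_on_matrix_symmetrizer_map smooth pos)
  moreover have "symmetric_matrix (?P U) \<and> positive_definite (?P U) \<and>
      symmetric_matrix (?P U ** matrix (system_map A U))" if U: "U \<in> ?N" for U
  proof (intro conjI)
    have "U \<in> states A"
      using U by blast
    then show "positive_definite (?P U)"
      by (intro positive_definite_symmetrizer_map spec_vol_pos bulk_modulus_pos)
    show "symmetric_matrix (?P U)"
      by (rule symmetric_matrix_symmetrizer_map)
    \<comment> \<open>Cramer's rule: the numerators combine to \<open>?d\<close> times the
      right-hand side. The quotient by \<open>?d\<close> stays uncancelled here; non-resonance
      cancels it afterwards.\<close>
    have "?f U k * ?\<delta> U k + ?g U k * ?\<kappa> U k = ?\<kappa> U k * ?b U k * ?d U k / ?d U k"
      "?f U k * ?r U k + ?g U k * ?\<delta> U k = ?r U k * ?c U k * ?d U k / ?d U k" for k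
      unfolding times_divide_eq_left add_divide_distrib[symmetric]
      by (simp_all add: algebra_simps power2_eq_square)
    then show "symmetric_matrix (?P U ** matrix (system_map A U))"
      unfolding system_map_def using d[OF U]
      by (intro symmetric_matrix_symmetrized_transport) simp_all
  qed
  ultimately show ?thesis
    unfolding symmetrizable_on_def by blast
qed

end

theorem proposition4p5:
  fixes A :: "2 \<Rightarrow> eos"
  assumes "\<forall>k. complete_eos (A k)"
  shows "\<exists>M. quasilinear_form A M \<and> symmetrizable_on {U \<in> states A. non_resonant A U} M"
  using quasilinear_form_system_map[OF assms] symmetrizable_system_map[OF assms] by blast

end
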